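(* Let $(\rho(\theta))_{\theta\in\mathbb{R}^L}$ be a second-order differentiable family of positive definite states on a finite-dimensional Hilbert space. For all $\alpha\in(0,1)$, the following integral representation holds for the Petz--Rényi information matrix: $$[\overline I_\alpha(\theta)]_{i,j}=\frac{\sin^2(\alpha\pi)}{\alpha(1-\alpha)\pi^2}\int_0^\infty\!\!\int_0^\infty ds\,dt\; s^\alpha t^{1-\alpha}\,\mathrm{Tr}\left[(\rho(\theta)+sI)^{-1}(\rho(\theta)+tI)^{-1}(\partial_i\rho(\theta))(\rho(\theta)+sI)^{-1}(\rho(\theta)+tI)^{-1}(\partial_j\rho(\theta))\right],$$ where $\partial_i=\frac{\partial}{\partial\theta_i}$ and $I$ is the identity operator.
   Context: A state is a positive semi-definite operator of unit trace. For positive definite states $\rho,\sigma$ and $\alpha\in(0,1)\cup(1,\infty)$, the Petz--Rényi relative entropy is $\overline D_\alpha(\rho\|\sigma):=\frac{1}{\alpha-1}\ln\mathrm{Tr}[\rho^\alpha\sigma^{1-\alpha}]$. The Petz--Rényi information matrix has entries $[\overline I_\alpha(\theta)]_{i,j}:=\frac1\alpha\left.\frac{\partial^2}{\partial\varepsilon_i\partial\varepsilon_j}\overline D_\alpha(\rho(\theta)\|\rho(\theta+\varepsilon))\right|_{\varepsilon=0}$. *)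

theory Defs
  imports "HOL-Analysis.Analysis"
begin

text \<open>Operators on a finite-dimensional Hilbert space are represented by square complex
  matrices with respect to an orthonormal basis indexed by \<open>'n\<close>.\<close>

definition cadjoint :: "complex^'n^'m \<Rightarrow> complex^'m^'n" where
  "cadjoint A = (\<chi> i j. cnj (A $ j $ i))"

definition hermitian_matrix :: "complex^'n^'n \<Rightarrow> bool" where
  "hermitian_matrix A \<longleftrightarrow> cadjoint A = A"

definition unitary_matrix :: "complex^'n^'n \<Rightarrow> bool" where
  "unitary_matrix U \<longleftrightarrow> cadjoint U ** U = mat 1 \<and> U ** cadjoint U = mat 1"

definition cinner :: "complex^'n \<Rightarrow> complex^'n \<Rightarrow> complex" where
  "cinner x y = (\<Sum>i\<in>UNIV. cnj (x $ i) * y $ i)"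

text \<open>For a Hermitian matrix the quadratic form is real, so taking the real part only
  changes the type.\<close>

definition positive_semidefinite :: "complex^'n^'n \<Rightarrow> bool" where
  "positive_semidefinite A \<longleftrightarrow> hermitian_matrix A \<and> (\<forall>x. 0 \<le> Re (cinner x (A *v x)))"

definition positive_definite :: "complex^'n^'n \<Rightarrow> bool" where
  "positive_definite A \<longleftrightarrow> hermitian_matrix A \<and> (\<forall>x. x \<noteq> 0 \<longrightarrow> 0 < Re (cinner x (A *v x)))"

definition is_state :: "complex^'n^'n \<Rightarrow> bool" where
  "is_state A \<longleftrightarrow> positive_semidefinite A \<and> trace A = 1"

definition real_diag :: "('n \<Rightarrow> real) \<Rightarrow> complex^'n^'n" where
  "real_diag d = (\<chi> i j. if i = j then complex_of_real (d i) else 0)"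

text \<open>Functional calculus through the spectral decomposition.  The result does not depend on
  the chosen decomposition (\<open>matrix_fun_eq\<close> below), so the description is proper for every
  Hermitian \<open>A\<close>.\<close>

definition matrix_fun :: "(real \<Rightarrow> real) \<Rightarrow> complex^'n^'n \<Rightarrow> complex^'n^'n" where
  "matrix_fun f A = (THE B. \<exists>U d. unitary_matrix U \<and>
     A = U ** real_diag d ** cadjoint U \<and> B = U ** real_diag (\<lambda>i. f (d i)) ** cadjoint U)"

lemma mult_real_diag_nth: "(A ** real_diag d) $ i $ j = A $ i $ j * complex_of_real (d j)"
proof -
  have "(A ** real_diag d) $ i $ j
      = (\<Sum>k\<in>UNIV. if k = j then A $ i $ k * complex_of_real (d k) else 0)"
    unfolding matrix_matrix_mult_def real_diag_def vec_lambda_beta by (intro sum.cong) simp_all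
  then show ?thesis by simp
qed

lemma real_diag_mult_nth: "(real_diag d ** A) $ i $ j = complex_of_real (d i) * A $ i $ j"
proof -
  have "(real_diag d ** A) $ i $ j
      = (\<Sum>k\<in>UNIV. if i = k then complex_of_real (d k) * A $ k $ j else 0)"
    unfolding matrix_matrix_mult_def real_diag_def vec_lambda_beta by (intro sum.cong) simp_all
  then show ?thesis by simp
qed

lemma matrix_fun_unique:
  assumes U: "unitary_matrix U" and V: "unitary_matrix V"
    and eq: "U ** real_diag d ** cadjoint U = V ** real_diag e ** cadjoint V"
  shows "U ** real_diag (\<lambda>i. f (d i)) ** cadjoint U = V ** real_diag (\<lambda>i. f (e i)) ** cadjoint V"
proof -
  let ?W = "cadjoint V ** U"
  have "?W ** real_diag d = cadjoint V ** (U ** real_diag d ** cadjoint U) ** U"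
    using U by (simp add: unitary_matrix_def flip: matrix_mul_assoc)
  also have "\<dots> = (cadjoint V ** V) ** real_diag e ** (cadjoint V ** U)"
    unfolding eq by (simp add: matrix_mul_assoc)
  also have "\<dots> = real_diag e ** ?W"
    using V by (simp add: unitary_matrix_def)
  finally have W: "?W ** real_diag d = real_diag e ** ?W" .
  have nth: "?W $ i $ j * complex_of_real (d j) = complex_of_real (e i) * ?W $ i $ j" for i j
    using arg_cong[OF W, of "\<lambda>M. M $ i $ j"] by (simp only: mult_real_diag_nth real_diag_mult_nth)
  have "?W $ i $ j * complex_of_real (f (d j)) = complex_of_real (f (e i)) * ?W $ i $ j" for i j
    using nth[of i j] by (cases "?W $ i $ j = 0") auto
  then have Wf: "?W ** real_diag (\<lambda>i. f (d i)) = real_diag (\<lambda>i. f (e i)) ** ?W"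
    by (simp only: vec_eq_iff mult_real_diag_nth real_diag_mult_nth) simp
  have "U ** real_diag (\<lambda>i. f (d i)) ** cadjoint U
      = (V ** cadjoint V) ** U ** real_diag (\<lambda>i. f (d i)) ** cadjoint U"
    using V by (simp add: unitary_matrix_def)
  also have "\<dots> = V ** (?W ** real_diag (\<lambda>i. f (d i))) ** cadjoint U"
    by (simp add: matrix_mul_assoc)
  also have "\<dots> = V ** real_diag (\<lambda>i. f (e i)) ** cadjoint V ** (U ** cadjoint U)"
    unfolding Wf by (simp add: matrix_mul_assoc)
  finally show ?thesis
    using U by (simp add: unitary_matrix_def)
qed

lemma matrix_fun_eq:
  assumes "unitary_matrix U"
  shows "matrix_fun f (U ** real_diag d ** cadjoint U)
    = U ** real_diag (\<lambda>i. f (d i)) ** cadjoint U"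
  unfolding matrix_fun_def
proof (rule the_equality)
  fix B assume "\<exists>V e. unitary_matrix V \<and>
    U ** real_diag d ** cadjoint U = V ** real_diag e ** cadjoint V \<and>
    B = V ** real_diag (\<lambda>i. f (e i)) ** cadjoint V"
  then obtain V e where "unitary_matrix V"
    and "U ** real_diag d ** cadjoint U = V ** real_diag e ** cadjoint V"
    and B: "B = V ** real_diag (\<lambda>i. f (e i)) ** cadjoint V"
    by blast
  then show "B = U ** real_diag (\<lambda>i. f (d i)) ** cadjoint U"
    unfolding B using matrix_fun_unique[OF assms] by metis
qed (use assms in blast)

definition matrix_powr :: "complex^'n^'n \<Rightarrow> real \<Rightarrow> complex^'n^'n" where
  "matrix_powr A p = matrix_fun (\<lambda>x. x powr p) A"

text \<open>The trace below is a positive real number for positive definite \<open>\<rho>\<close> and \<open>\<sigma>\<close>;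
  \<open>Re\<close> only changes the type.\<close>

definition petz_renyi_entropy :: "real \<Rightarrow> complex^'n^'n \<Rightarrow> complex^'n^'n \<Rightarrow> real" where
  "petz_renyi_entropy \<alpha> \<rho> \<sigma> =
     1 / (\<alpha> - 1) * ln (Re (trace (matrix_powr \<rho> \<alpha> ** matrix_powr \<sigma> (1 - \<alpha>))))"

definition partial_deriv :: "'l \<Rightarrow> (real^'l \<Rightarrow> 'b::real_normed_vector) \<Rightarrow> real^'l \<Rightarrow> 'b" where
  "partial_deriv i f x = vector_derivative (\<lambda>h. f (x + h *\<^sub>R axis i 1)) (at 0)"

definition twice_differentiable ::
    "('a::real_normed_vector \<Rightarrow> 'b::real_normed_vector) \<Rightarrow> bool" where
  "twice_differentiable f \<longleftrightarrow>
     (\<exists>f' :: 'a \<Rightarrow> 'a \<Rightarrow>\<^sub>L 'b.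
        (\<forall>x. (f has_derivative blinfun_apply (f' x)) (at x)) \<and> (\<forall>x. f' differentiable at x))"

definition petz_renyi_information ::
    "real \<Rightarrow> (real^'l \<Rightarrow> complex^'n^'n) \<Rightarrow> real^'l \<Rightarrow> real^'l^'l" where
  "petz_renyi_information \<alpha> \<rho> \<theta> = (\<chi> i j.
     1 / \<alpha> * partial_deriv i (partial_deriv j
       (\<lambda>\<epsilon>. petz_renyi_entropy \<alpha> (\<rho> \<theta>) (\<rho> (\<theta> + \<epsilon>)))) 0)"

end

theory Submission
  imports Defs
begin

text \<open>Write \<open>\<beta> = 1 - \<alpha>\<close>.  The integral representation of \<open>x powr p\<close>, applied to a matrix, and the
  resolvent identity give \<open>T\<^sup>p - S\<^sup>p = K\<^sub>p(S, T)[T - S]\<close> with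
  \<open>K\<^sub>p(S, T)[Z] = sin(p pi) / pi \<cdot> \<integral> t\<^sup>p (S + t)\<^sup>-\<^sup>1 Z (T + t)\<^sup>-\<^sup>1 dt\<close>.  Dominated convergence makes
  \<open>K\<^sub>p\<close> continuous, so \<open>K\<^sub>p(S, S)\<close> is the derivative of \<open>S \<mapsto> S\<^sup>p\<close>.  Moreover
  \<open>Tr(S\<^sup>\<alpha> K\<^sub>\<beta>(S, S)[Z]) = \<beta> Tr Z\<close>, which vanishes for the derivative \<open>Z\<close> of a family of states.
  The first derivative of \<open>Tr(\<rho>(\<theta>)\<^sup>\<alpha> \<sigma>\<^sup>\<beta>)\<close> at \<open>\<sigma> = \<rho>(\<theta> + \<epsilon>)\<close> is therefore
  \<open>Tr((\<rho>(\<theta>)\<^sup>\<alpha> - \<sigma>\<^sup>\<alpha>) K\<^sub>\<beta>(\<sigma>, \<sigma>)[\<partial>\<^sub>j \<sigma>])\<close>, whose first factor vanishes at \<open>\<epsilon> = 0\<close>.  Hence the second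
  derivative there is \<open>- Tr(K\<^sub>\<alpha>[\<partial>\<^sub>i \<rho>] K\<^sub>\<beta>[\<partial>\<^sub>j \<rho>])\<close>, and by cyclicity of the trace this is minus
  \<open>(sin(\<alpha> pi) / pi)\<^sup>2\<close> times the double integral.\<close>

section \<open>Integrals over the half line\<close>

text \<open>The substitution \<open>u = t / (x + t)\<close> maps the half line onto the open unit
  interval and turns Euler's Beta integral into this one, up to the factor \<open>x powr b\<close>.
  The integrand is nonnegative, so its gauge integral is a Lebesgue integral.\<close>

lemma beta_integral_half_line:
  fixes a b x :: real
  assumes a: "0 < a" and b: "0 < b" and x: "0 < x"
  shows "has_bochner_integral lborel
    (\<lambda>t. indicator {0<..} t *\<^sub>R (t powr (a - 1) / (x + t) powr (a + b))) (x powr (- b) * Beta a b)"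
proof -
  let ?f = "\<lambda>u::real. u powr (a - 1) * (1 - u) powr (b - 1)"
  let ?g = "\<lambda>t. t / (x + t)"
  let ?h = "\<lambda>t. t powr (a - 1) / (x + t) powr (a + b)"
  have image: "?g ` {0<..} = {0<..<1}"
  proof (intro equalityI subsetI)
    fix u :: real assume u: "u \<in> {0<..<1}"
    then have "u = ?g (x * u / (1 - u))"
      using x by (simp add: field_simps)
    moreover have "x * u / (1 - u) \<in> {0<..}"
      using u x by simp
    ultimately show "u \<in> ?g ` {0<..}"
      by blast
  qed (use x in auto)
  have "(?f has_integral Beta a b) {0<..<1}"
    using has_integral_Beta_real[OF a b] by (simp add: has_integral_Icc_iff_Ioo)
  then have "?f absolutely_integrable_on ?g ` {0<..}" "integral (?g ` {0<..}) ?f = Beta a b"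
    unfolding image by (auto intro!: nonnegative_absolutely_integrable_1 simp: integral_unique)
  moreover have "(?g has_field_derivative x / (x + t)\<^sup>2) (at t within {0<..})" if "t \<in> {0<..}" for t
    using x that by (auto intro!: derivative_eq_intros simp: power2_eq_square)
  moreover have "inj_on ?g {0<..}"
    using x by (auto simp: inj_on_def field_simps)
  ultimately have *: "(\<lambda>t. \<bar>x / (x + t)\<^sup>2\<bar> * ?f (?g t)) absolutely_integrable_on {0<..}"
      "integral {0<..} (\<lambda>t. \<bar>x / (x + t)\<^sup>2\<bar> * ?f (?g t)) = Beta a b"
    using has_absolute_integral_change_of_variables_1'[of "{0<..}" ?g "\<lambda>t. x / (x + t)\<^sup>2" ?f "Beta a b"]
    by auto
  have eq: "\<bar>x / (x + t)\<^sup>2\<bar> * ?f (?g t) = x powr b * ?h t" if "t \<in> {0<..}" for t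
  proof -
    have t: "0 < t" using that by simp
    have "1 - ?g t = x / (x + t)"
      using x t by (simp add: field_simps)
    moreover have "x powr b = x * x powr (b - 1)"
      using x by (simp add: powr_mult_base)
    moreover have "(x + t) powr (a + b) = (x + t)\<^sup>2 * (x + t) powr (a - 1) * (x + t) powr (b - 1)"
      using x t by (simp flip: powr_add powr_numeral)
    ultimately show ?thesis
      using x t by (simp add: powr_divide) (simp only: mult_ac)
  qed
  have "((\<lambda>t. \<bar>x / (x + t)\<^sup>2\<bar> * ?f (?g t)) has_integral Beta a b) {0<..}"
    using set_lebesgue_integral_eq_integral(1)[OF *(1)] *(2) by (auto simp: has_integral_iff)
  then have "((\<lambda>t. x powr b * ?h t) has_integral Beta a b) {0<..}"
    by (rule has_integral_eq[rotated]) (rule eq)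
  then have "((\<lambda>t. x powr (- b) * (x powr b * ?h t)) has_integral x powr (- b) * Beta a b) {0<..}"
    by (rule has_integral_mult_right)
  moreover have "x powr (- b) * (x powr b * ?h t) = ?h t" for t
    using x by (simp only: mult.assoc[symmetric] powr_add[symmetric]) simp
  ultimately have int: "(?h has_integral x powr (- b) * Beta a b) {0<..}"
    by (simp only:)
  have "(\<integral>\<^sup>+t. ennreal (indicator {0<..} t *\<^sub>R ?h t) \<partial>lborel)
      = ennreal (x powr (- b) * Beta a b)"
    unfolding real_scaleR_def by (rule nn_integral_has_integral_lebesgue[OF _ int]) simp
  moreover have "0 \<le> Beta a b"
    using a b by (simp add: Beta_def)
  ultimately show ?thesis
    by (intro has_bochner_integral_nn_integral) simp_all
qed

text \<open>Euler's reflection formula, read off from the complex Gamma function.\<close>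

lemma Beta_one_minus:
  fixes p :: real
  assumes "0 < p" and "p < 1"
  shows "Beta p (1 - p) = pi / sin (p * pi)"
proof -
  have "complex_of_real (Gamma p * Gamma (1 - p)) = Gamma (of_real p) * Gamma (1 - of_real p)"
    by (simp flip: Gamma_complex_of_real)
  also have "\<dots> = of_real (pi / sin (p * pi))"
    unfolding Gamma_reflection_complex by (simp add: mult.commute flip: sin_of_real)
  finally show ?thesis
    unfolding Beta_def of_real_eq_iff by simp
qed

text \<open>Since \<open>1 / t - 1 / (x + t) = x / (t * (x + t))\<close>, this is \<open>x\<close>
  times a Beta integral. Each of the two fractions alone would diverge at infinity; the term
  \<open>1 / t\<close> restores convergence and cancels when two values of \<open>x\<close> are
  compared.\<close>

lemma powr_integral_representation:
  fixes p x :: real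
  assumes p: "0 < p" "p < 1" and x: "0 < x"
  shows "has_bochner_integral lborel
    (\<lambda>t. indicator {0<..} t *\<^sub>R (t powr p * (1 / t - 1 / (x + t)))) (pi / sin (p * pi) * x powr p)"
proof -
  have "has_bochner_integral lborel
      (\<lambda>t. x *\<^sub>R (indicator {0<..} t *\<^sub>R (t powr (p - 1) / (x + t) powr (p + (1 - p)))))
      (x *\<^sub>R (x powr (- (1 - p)) * Beta p (1 - p)))"
    using p x by (intro has_bochner_integral_scaleR_right beta_integral_half_line) auto
  also have "(\<lambda>t. x *\<^sub>R (indicator {0<..} t *\<^sub>R (t powr (p - 1) / (x + t) powr (p + (1 - p)))))
      = (\<lambda>t. indicator {0<..} t *\<^sub>R (t powr p * (1 / t - 1 / (x + t))))"
  proof (intro ext)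
    fix t :: real
    show "x *\<^sub>R (indicator {0<..} t *\<^sub>R (t powr (p - 1) / (x + t) powr (p + (1 - p))))
      = indicator {0<..} t *\<^sub>R (t powr p * (1 / t - 1 / (x + t)))"
    proof (cases "0 < t")
      case True
      then have "1 / t - 1 / (x + t) = x / (t * (x + t))"
        using x by (simp add: divide_simps)
      then show ?thesis
        using True x by (simp add: powr_diff)
    qed simp
  qed
  also have "x *\<^sub>R (x powr (- (1 - p)) * Beta p (1 - p)) = pi / sin (p * pi) * x powr p"
    using p x by (simp add: Beta_one_minus powr_diff)
  finally show ?thesis .
qed

text \<open>Formally the derivative in \<open>x\<close> of the preceding formula, obtained from the
  Beta integral with first parameter \<open>p + 1\<close> instead of differentiating under the
  integral. It also supplies the dominating functions further below.\<close>

lemma powr_deriv_integral_representation: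
  fixes p x :: real
  assumes p: "0 < p" "p < 1" and x: "0 < x"
  shows "has_bochner_integral lborel
    (\<lambda>t. indicator {0<..} t *\<^sub>R (t powr p / (x + t)\<^sup>2)) (pi / sin (p * pi) * (p * x powr (p - 1)))"
proof -
  have "(p + (1 - p)) * Beta (p + 1) (1 - p) = p * Beta p (1 - p)"
    using p by (intro Beta_plus1_left) (auto elim!: nonpos_Ints_cases)
  then have "Beta (p + 1) (1 - p) = p * (pi / sin (p * pi))"
    using p by (simp add: Beta_one_minus)
  moreover have "(\<lambda>t. indicator {0<..} t *\<^sub>R (t powr (p + 1 - 1) / (x + t) powr (p + 1 + (1 - p))))
      = (\<lambda>t. indicator {0<..} t *\<^sub>R (t powr p / (x + t)\<^sup>2))"
    using x by (auto simp: fun_eq_iff indicator_def)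
  ultimately show ?thesis
    using beta_integral_half_line[of "p + 1" "1 - p" x] p x
    by (simp only:) (simp add: mult_ac)
qed

section \<open>The spectral theorem for Hermitian matrices\<close>

lemma cadjoint_nth: "cadjoint A $ i $ j = cnj (A $ j $ i)"
  by (simp add: cadjoint_def)

lemma cadjoint_cadjoint [simp]: "cadjoint (cadjoint A) = A"
  by (simp add: vec_eq_iff cadjoint_nth)

lemma cadjoint_mult: "cadjoint (A ** B) = cadjoint B ** cadjoint A"
  by (simp add: vec_eq_iff cadjoint_nth matrix_matrix_mult_def mult.commute)

lemma cadjoint_real_diag [simp]: "cadjoint (real_diag d) = real_diag d"
  by (simp add: vec_eq_iff cadjoint_nth real_diag_def)

lemma linear_cadjoint: "linear (cadjoint :: complex^'n^'m \<Rightarrow> _)"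
  by (rule linearI) (simp_all add: vec_eq_iff cadjoint_nth)

lemma linear_trace: "linear (trace :: complex^'n^'n \<Rightarrow> complex)"
  by (rule linearI) (simp_all add: trace_def sum.distrib scaleR_sum_right)

lemma bounded_linear_trace: "bounded_linear (trace :: complex^'n^'n \<Rightarrow> complex)"
  using linear_trace by (simp add: linear_conv_bounded_linear)

lemma trace_cadjoint: "trace (cadjoint A) = cnj (trace A)"
  by (simp add: trace_def cadjoint_nth)

lemma bounded_bilinear_matrix_mult:
  "bounded_bilinear ((**) :: complex^'n^'m \<Rightarrow> complex^'k^'n \<Rightarrow> complex^'k^'m)"
  unfolding bilinear_conv_bounded_bilinear[symmetric] bilinear_def
  by (auto intro!: linearI
      simp: vec_eq_iff matrix_matrix_mult_def sum.distrib scaleR_sum_right algebra_simps)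

lemma bounded_bilinear_matrix_vector_mult:
  "bounded_bilinear ((*v) :: complex^'n^'m \<Rightarrow> complex^'n \<Rightarrow> complex^'m)"
  unfolding bilinear_conv_bounded_bilinear[symmetric] bilinear_def
  by (auto intro!: linearI
      simp: vec_eq_iff matrix_vector_mult_def sum.distrib scaleR_sum_right algebra_simps)

interpretation matrix_mult: bounded_bilinear
    "(**) :: complex^'n^'m \<Rightarrow> complex^'k^'n \<Rightarrow> complex^'k^'m"
  by (rule bounded_bilinear_matrix_mult)

interpretation matrix_vector_mult: bounded_bilinear
    "(*v) :: complex^'n^'m \<Rightarrow> complex^'n \<Rightarrow> complex^'m"
  by (rule bounded_bilinear_matrix_vector_mult)

text \<open>Connects the Hermitian form with the Euclidean structure of \<open>complex^'n\<close>,
  where compactness and the Cauchy-Schwarz inequality are at hand.\<close>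

lemma Re_cinner: "Re (cinner x y) = x \<bullet> y"
  by (simp add: cinner_def inner_vec_def inner_complex_def)

lemma cinner_add_right: "cinner x (y + z) = cinner x y + cinner x z"
  by (simp add: cinner_def sum.distrib algebra_simps)

lemma cinner_smult_left: "cinner (c *s x) y = cnj c * cinner x y"
  by (simp add: cinner_def sum_distrib_left mult_ac)

lemma cinner_scaleR_right: "cinner x (r *\<^sub>R y) = r *\<^sub>R cinner x y"
  by (simp add: cinner_def scaleR_sum_right)

lemma cinner_commute: "cinner y x = cnj (cinner x y)"
  by (simp add: cinner_def mult.commute)

lemma cinner_self: "cinner x x = of_real ((norm x)\<^sup>2)"
  by (rule complex_eqI)
    (simp_all add: Re_cinner dot_square_norm, simp add: cinner_def sum_nonneg)

lemma cinner_adjoint: "cinner x (A *v y) = cinner (cadjoint A *v x) y"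
proof -
  have "cinner x (A *v y) = (\<Sum>i\<in>UNIV. \<Sum>j\<in>UNIV. cnj (x $ i) * (A $ i $ j * y $ j))"
    by (simp add: cinner_def matrix_vector_mult_def sum_distrib_left)
  also have "\<dots> = (\<Sum>j\<in>UNIV. \<Sum>i\<in>UNIV. cnj (x $ i) * (A $ i $ j * y $ j))"
    by (rule sum.swap)
  also have "\<dots> = cinner (cadjoint A *v x) y"
    by (simp add: cinner_def matrix_vector_mult_def sum_distrib_left sum_distrib_right cadjoint_nth mult_ac)
  finally show ?thesis .
qed

lemma cinner_hermitian: "hermitian_matrix A \<Longrightarrow> cinner x (A *v y) = cinner (A *v x) y"
  by (metis cinner_adjoint hermitian_matrix_def)

text \<open>The eigenvector maximises the quadratic form on the unit sphere of \<open>W\<close>; the first order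
  condition is tested with \<open>z = A x - m x\<close> itself.\<close>

lemma hermitian_eigenvector_in_invariant_subspace:
  fixes A :: "complex^'n^'n"
  assumes A: "hermitian_matrix A" and W: "subspace W" and inv: "\<And>x. x \<in> W \<Longrightarrow> A *v x \<in> W"
    and ne: "W \<noteq> {0}"
  obtains x m where "x \<in> W" "norm x = 1" "A *v x = complex_of_real m *s x"
proof -
  have sym: "x \<bullet> (A *v y) = (A *v x) \<bullet> y" for x y
    using cinner_hermitian[OF A] by (metis Re_cinner)
  obtain w where w: "w \<in> W" "w \<noteq> 0"
    using ne W subspace_0 by blast
  have "compact (W \<inter> sphere 0 1)"
    using closed_subspace[OF W] by (simp add: closed_Int_compact)
  moreover have "(1 / norm w) *\<^sub>R w \<in> W \<inter> sphere 0 1"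
    using w W by (simp add: subspace_scale)
  moreover have "continuous_on (W \<inter> sphere 0 1) (\<lambda>x. x \<bullet> (A *v x))"
    by (intro continuous_intros matrix_vector_mult.continuous_on)
  ultimately obtain x where x: "x \<in> W" "norm x = 1"
    and max: "\<And>y. y \<in> W \<Longrightarrow> norm y = 1 \<Longrightarrow> y \<bullet> (A *v y) \<le> x \<bullet> (A *v x)"
    using continuous_attains_sup[of "W \<inter> sphere 0 1" "\<lambda>x. x \<bullet> (A *v x)"] by fastforce
  have xx: "x \<bullet> x = 1"
    using x by (simp add: dot_square_norm)
  define m where "m = x \<bullet> (A *v x)"
  have le: "y \<bullet> (A *v y) \<le> m * (norm y)\<^sup>2" if y: "y \<in> W" for y
  proof (cases "y = 0")
    case False
    have "((1 / norm y) *\<^sub>R y) \<bullet> (A *v ((1 / norm y) *\<^sub>R y)) \<le> m"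
      unfolding m_def using False y W by (intro max) (auto intro: subspace_scale)
    then have "(1 / (norm y)\<^sup>2) * (y \<bullet> (A *v y)) \<le> m"
      by (simp add: matrix_vector_mult.scaleR_right power2_eq_square)
    then show ?thesis
      using False by (simp add: field_simps)
  qed simp
  define z where "z = A *v x - m *\<^sub>R x"
  have zW: "z \<in> W"
    unfolding z_def using x inv W by (intro subspace_diff subspace_scale) auto
  \<comment> \<open>At \<open>x + h *\<^sub>R z\<close> the quadratic form and its upper bound
    differ to first order by \<open>2 * h * (z \<bullet> z)\<close>; the rest has order
    \<open>h\<^sup>2\<close>. Dividing by \<open>2 * h\<close> leaves a bound that vanishes as
    \<open>h\<close> tends to 0 from the right.\<close>
  have "z \<bullet> z \<le> h * (m * (z \<bullet> z) - z \<bullet> (A *v z)) / 2" if h: "0 < h" for h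
  proof -
    have "(x + h *\<^sub>R z) \<bullet> (A *v (x + h *\<^sub>R z)) \<le> m * (norm (x + h *\<^sub>R z))\<^sup>2"
      using x zW W by (intro le subspace_add subspace_scale)
    moreover have "(x + h *\<^sub>R z) \<bullet> (A *v (x + h *\<^sub>R z))
        = m + 2 * h * (z \<bullet> (A *v x)) + h\<^sup>2 * (z \<bullet> (A *v z))"
      using sym[of x z] by (simp add: matrix_vector_mult.add_right matrix_vector_mult.scaleR_right inner_add m_def
          inner_commute[of _ z] power2_eq_square algebra_simps)
    moreover have "(norm (x + h *\<^sub>R z))\<^sup>2 = 1 + 2 * h * (z \<bullet> x) + h\<^sup>2 * (z \<bullet> z)"
      unfolding power2_norm_eq_inner using xx
      by (simp add: inner_add inner_commute[of x z] power2_eq_square algebra_simps)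
    ultimately have "2 * h * (z \<bullet> (A *v x) - m * (z \<bullet> x)) \<le> h * (h * (m * (z \<bullet> z) - z \<bullet> (A *v z)))"
      by (simp add: algebra_simps power2_eq_square)
    moreover have "z \<bullet> (A *v x) - m * (z \<bullet> x) = z \<bullet> z"
      by (simp add: z_def inner_diff)
    ultimately show ?thesis
      using h by (simp add: mult.assoc mult.left_commute[of 2])
  qed
  moreover have "((\<lambda>h. h * (m * (z \<bullet> z) - z \<bullet> (A *v z)) / 2) \<longlongrightarrow> 0) (at_right 0)"
    by (auto intro!: tendsto_eq_intros)
  ultimately have "z \<bullet> z \<le> 0"
    by (intro tendsto_lowerbound[of _ _ "at_right (0::real)"])
      (auto simp: eventually_at_right_less intro: eventually_at_rightI[of 0 1])
  then have "z = 0"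
    using inner_gt_zero_iff[of z] by linarith
  then have "A *v x = m *\<^sub>R x"
    by (simp add: z_def)
  also have "\<dots> = complex_of_real m *s x"
    by (simp add: vec_eq_iff complex_eq_iff)
  finally show thesis
    using x that by blast
qed

text \<open>Induction on the index set: the vectors orthogonal to the eigenvectors found so far form
  an invariant subspace, which is non-trivial as long as an index is left over.\<close>

lemma hermitian_orthonormal_eigenvectors:
  fixes A :: "complex^'n^'n" and S :: "'n set"
  assumes A: "hermitian_matrix A"
  shows "\<exists>v d. \<forall>i\<in>S. A *v v i = complex_of_real (d i) *s v i
    \<and> (\<forall>j\<in>S. cinner (v i) (v j) = (if i = j then 1 else 0))"
  using finite[of S]
proof (induction S rule: finite_induct)
  case (insert k S)
  then obtain v d where eig: "\<And>i. i \<in> S \<Longrightarrow> A *v v i = complex_of_real (d i) *s v i"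
    and orth: "\<And>i j. i \<in> S \<Longrightarrow> j \<in> S \<Longrightarrow> cinner (v i) (v j) = (if i = j then 1 else 0)"
    by blast
  \<comment> \<open>\<open>\<phi>\<close> lists the inner products with the eigenvectors found so
    far, padded by 0. Its coordinate at \<open>k\<close> is always 0, so it is not onto, and by
    finite dimension it has a non-trivial kernel.\<close>
  define \<phi> :: "complex^'n \<Rightarrow> complex^'n" where "\<phi> x = (\<chi> i. if i \<in> S then cinner (v i) x else 0)" for x
  have lin: "linear \<phi>"
    by (rule linearI) (simp_all add: \<phi>_def vec_eq_iff cinner_add_right cinner_scaleR_right)
  define W where "W = {x. \<phi> x = 0}"
  have W_iff: "x \<in> W \<longleftrightarrow> (\<forall>i\<in>S. cinner (v i) x = 0)" for x
    by (auto simp: W_def \<phi>_def vec_eq_iff)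
  have "\<phi> x \<noteq> axis k 1" for x
    using insert.hyps by (auto simp: \<phi>_def vec_eq_iff axis_def intro!: exI[of _ k])
  then have "\<not> inj \<phi>"
    using linear_injective_imp_surjective[OF lin] by (metis surjD)
  then have "W \<noteq> {0}"
    unfolding W_def using linear_injective_0[OF lin] linear_0[OF lin] by auto
  moreover have "subspace W"
    unfolding W_def using lin by (rule linear_subspace_kernel)
  moreover have "A *v x \<in> W" if "x \<in> W" for x
    using that by (simp add: W_iff cinner_hermitian[OF A] eig cinner_smult_left)
  ultimately obtain x m where x: "x \<in> W" "norm x = 1" "A *v x = complex_of_real m *s x"
    using hermitian_eigenvector_in_invariant_subspace[OF A, of W] by blast
  have "cinner (v i) x = 0" "cinner x (v i) = 0" if "i \<in> S" for i
    using that x W_iff cinner_commute[of x "v i"] by auto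
  then show ?case
    using insert.hyps x eig orth cinner_self[of x]
    by (intro exI[of _ "v(k := x)"] exI[of _ "d(k := m)"]) auto
qed simp

theorem hermitian_spectral_decomposition:
  fixes A :: "complex^'n^'n"
  assumes "hermitian_matrix A"
  obtains U d where "unitary_matrix U" "A = U ** real_diag d ** cadjoint U"
proof -
  obtain v :: "'n \<Rightarrow> complex^'n" and d where eig: "\<And>i. A *v v i = complex_of_real (d i) *s v i"
    and orth: "\<And>i j. cinner (v i) (v j) = (if i = j then 1 else 0)"
    using hermitian_orthonormal_eigenvectors[OF assms, of UNIV] by blast
  \<comment> \<open>The eigenvectors become the columns of \<open>U\<close>, so their orthonormality
    is \<open>cadjoint U ** U = mat 1\<close>.\<close>
  define U where "U = (\<chi> i j. v j $ i)"
  have UU: "cadjoint U ** U = mat 1"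
    using orth unfolding cinner_def
    by (simp add: vec_eq_iff matrix_matrix_mult_def cadjoint_nth U_def mat_def)
  then have U: "unitary_matrix U"
    by (simp add: unitary_matrix_def matrix_left_right_inverse1[OF UU])
  have "(A ** U) $ i $ j = (U ** real_diag d) $ i $ j" for i j
  proof -
    have "(A ** U) $ i $ j = (A *v v j) $ i"
      by (simp add: U_def matrix_matrix_mult_def matrix_vector_mult_def)
    also have "\<dots> = (U ** real_diag d) $ i $ j"
      by (simp only: eig mult_real_diag_nth) (simp add: U_def)
    finally show ?thesis .
  qed
  then have AU: "A ** U = U ** real_diag d"
    by (simp add: vec_eq_iff)
  have "A = A ** (U ** cadjoint U)"
    using U by (simp add: unitary_matrix_def)
  also have "\<dots> = U ** real_diag d ** cadjoint U"
    by (simp only: matrix_mul_assoc AU)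
  finally show thesis
    by (rule that[OF U])
qed

section \<open>Resolvents\<close>

text \<open>For Hermitian \<open>S\<close> this says that all eigenvalues are at least
  \<open>m\<close>. Such a quantitative form of positivity is stable under small perturbations and
  gives bounds that are uniform along a convergent sequence.\<close>

definition coercive :: "real \<Rightarrow> complex^'n^'n \<Rightarrow> bool" where
  "coercive m S \<longleftrightarrow> (\<forall>x. m * (norm x)\<^sup>2 \<le> x \<bullet> (S *v x))"

lemma coercive_mono: "coercive m S \<Longrightarrow> m' \<le> m \<Longrightarrow> coercive m' S"
  unfolding coercive_def by (meson mult_right_mono order_trans zero_le_power2)

text \<open>The quadratic form attains its minimum on the compact unit sphere, and scaling extends
  the bound to all vectors.\<close>

lemma positive_definite_coercive:
  fixes S :: "complex^'n^'n"
  assumes "positive_definite S"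
  obtains m where "0 < m" "coercive m S"
proof -
  \<comment> \<open>\<open>undefined\<close> stands for an arbitrary index; index types are
    non-empty, so the sphere is too.\<close>
  have "axis undefined 1 \<in> sphere (0 :: complex^'n) 1"
    by (simp add: norm_eq_sqrt_inner inner_axis_axis)
  then have "sphere (0 :: complex^'n) 1 \<noteq> {}"
    by blast
  moreover have "continuous_on (sphere 0 1) (\<lambda>x. x \<bullet> (S *v x))"
    by (intro continuous_intros matrix_vector_mult.continuous_on)
  ultimately obtain x where x: "norm x = 1" and min: "\<And>y. norm y = 1 \<Longrightarrow> x \<bullet> (S *v x) \<le> y \<bullet> (S *v y)"
    using continuous_attains_inf[of "sphere (0 :: complex^'n) 1" "\<lambda>x. x \<bullet> (S *v x)"] by auto
  have "x \<noteq> 0"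
    using x by auto
  show thesis
  proof
    show "0 < x \<bullet> (S *v x)"
      using assms \<open>x \<noteq> 0\<close> by (simp add: positive_definite_def Re_cinner)
    show "coercive (x \<bullet> (S *v x)) S"
      unfolding coercive_def
    proof
      fix y
      show "x \<bullet> (S *v x) * (norm y)\<^sup>2 \<le> y \<bullet> (S *v y)"
      proof (cases "y = 0")
        case False
        then have "x \<bullet> (S *v x) \<le> ((1 / norm y) *\<^sub>R y) \<bullet> (S *v ((1 / norm y) *\<^sub>R y))"
          by (intro min) simp
        also have "\<dots> = (y \<bullet> (S *v y)) / (norm y)\<^sup>2"
          by (simp add: matrix_vector_mult.scaleR_right power2_eq_square)
        finally show ?thesis
          using False by (simp add: field_simps)
      qed simp
    qed
  qed
qed

text \<open>A perturbation changes the quadratic form by at most \<open>K\<close> times its norm,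
  relative to the squared norm of the vector. The radius \<open>m / (2 * K)\<close> thus costs at
  most half of \<open>m\<close>.\<close>

lemma eventually_coercive:
  fixes S :: "'a \<Rightarrow> complex^'n^'n"
  assumes S: "(S \<longlongrightarrow> L) F" and m: "0 < m" and L: "coercive m L"
  shows "\<forall>\<^sub>F n in F. coercive (m / 2) (S n)"
proof -
  obtain K where K: "0 < K" "\<And>A x. norm (A *v x :: complex^'n) \<le> norm (A :: complex^'n^'n) * norm x * K"
    using matrix_vector_mult.pos_bounded by blast
  have "\<forall>\<^sub>F n in F. dist (S n) L < m / (2 * K)"
    using S m K by (intro tendstoD) auto
  then show ?thesis
  proof eventually_elim
    case (elim n)
    show ?case
      unfolding coercive_def
    proof
      fix x
      have "\<bar>x \<bullet> ((S n - L) *v x)\<bar> \<le> norm x * norm ((S n - L) *v x)"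
        by (rule Cauchy_Schwarz_ineq2)
      also have "\<dots> \<le> norm x * (norm (S n - L) * norm x * K)"
        by (rule mult_left_mono[OF K(2)]) simp
      also have "\<dots> = (norm (S n - L) * K) * (norm x)\<^sup>2"
        by (simp add: power2_eq_square)
      also have "\<dots> \<le> (m / 2) * (norm x)\<^sup>2"
        using elim K by (intro mult_right_mono) (simp_all add: dist_norm field_simps)
      finally have "- (m / 2) * (norm x)\<^sup>2 \<le> x \<bullet> ((S n - L) *v x)"
        by simp
      moreover have "m * (norm x)\<^sup>2 \<le> x \<bullet> (L *v x)"
        using L by (simp add: coercive_def)
      ultimately show "m / 2 * (norm x)\<^sup>2 \<le> x \<bullet> (S n *v x)"
        by (simp add: matrix_vector_mult.diff_left inner_diff_right)
    qed
  qed
qed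

section \<open>Inverses of matrices and their continuity\<close>

lemma matrix_inv_eqI:
  fixes A :: "complex^'n^'n"
  assumes "B ** A = mat 1"
  shows "matrix_inv A = B"
proof -
  have "A ** matrix_inv A = mat 1 \<and> matrix_inv A ** A = mat 1"
    unfolding matrix_inv_def
    by (rule someI[of _ B]) (simp add: assms matrix_left_right_inverse1[OF assms])
  then have "B ** (A ** matrix_inv A) = B"
    by simp
  then show ?thesis
    by (simp add: matrix_mul_assoc assms)
qed

text \<open>The resolvent identity in abstract form: the right-hand side expands to
  \<open>A' ** B ** B' - A' ** A ** B'\<close>.\<close>

lemma inverse_matrix_diff:
  fixes A B :: "complex^'n^'n"
  assumes "A' ** A = mat 1" and "B ** B' = mat 1"
  shows "A' - B' = A' ** (B - A) ** B'"
  by (simp add: matrix_mult.diff_left matrix_mult.diff_right assms flip: matrix_mul_assoc)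

text \<open>By the resolvent identity \<open>A' n - L'\<close> is the bounded \<open>A' n\<close>
  times a null sequence.\<close>

lemma tendsto_inverse_matrix:
  fixes A :: "'a \<Rightarrow> complex^'n^'n"
  assumes A: "(A \<longlongrightarrow> L) F" and inv: "\<forall>\<^sub>F n in F. A' n ** A n = mat 1" and L: "L ** L' = mat 1"
    and bdd: "\<forall>\<^sub>F n in F. norm (A' n) \<le> C"
  shows "(A' \<longlongrightarrow> L') F"
proof -
  have "((\<lambda>n. (L - A n) ** L') \<longlongrightarrow> (L - L) ** L') F"
    by (intro matrix_mult.tendsto tendsto_intros A)
  then have "Zfun (\<lambda>n. (L - A n) ** L') F"
    by (simp add: tendsto_Zfun_iff)
  then have "Zfun (\<lambda>n. A' n ** ((L - A n) ** L')) F"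
    by (rule matrix_mult.Bfun_prod_Zfun[OF BfunI[OF bdd]])
  then have "((\<lambda>n. A' n ** ((L - A n) ** L') + L') \<longlongrightarrow> L') F"
    by (simp add: tendsto_Zfun_iff)
  moreover have "\<forall>\<^sub>F n in F. A' n ** ((L - A n) ** L') + L' = A' n"
    using inv by eventually_elim (simp add: matrix_mul_assoc flip: inverse_matrix_diff[OF _ L])
  ultimately show ?thesis
    by (rule Lim_transform_eventually)
qed

text \<open>The sign is chosen so that for \<open>S\<close> coercive with a positive constant all
  parameters \<open>t\<close> from 0 upwards are regular.\<close>

definition resolvent :: "complex^'n^'n \<Rightarrow> real \<Rightarrow> complex^'n^'n" where
  "resolvent S t = matrix_inv (S + t *\<^sub>R mat 1)"

text \<open>Pair \<open>(S + t *\<^sub>R mat 1) *v x\<close> with \<open>x\<close> and apply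
  Cauchy-Schwarz. The bound yields both injectivity and the decay of the inverse in
  \<open>t\<close>.\<close>

lemma resolvent_norm_vector:
  assumes S: "coercive m S" and m: "0 < m" and t: "0 \<le> t"
  shows "(m + t) * norm x \<le> norm ((S + t *\<^sub>R mat 1) *v x)"
proof (cases "x = 0")
  case False
  have "(m + t) * norm x * norm x \<le> x \<bullet> ((S + t *\<^sub>R mat 1) *v x)"
    using S[unfolded coercive_def, rule_format, of x]
    by (simp add: matrix_vector_mult.add_left matrix_vector_mult.scaleR_left inner_add_right
        dot_square_norm power2_eq_square algebra_simps)
  also have "\<dots> \<le> norm ((S + t *\<^sub>R mat 1) *v x) * norm x"
    using Cauchy_Schwarz_ineq2[of x "(S + t *\<^sub>R mat 1) *v x"] by (simp add: mult.commute)
  finally show ?thesis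
    using False by simp
qed simp

lemma resolvent_inverse:
  assumes S: "coercive m S" and m: "0 < m" and t: "0 \<le> t"
  shows "resolvent S t ** (S + t *\<^sub>R mat 1) = mat 1" "(S + t *\<^sub>R mat 1) ** resolvent S t = mat 1"
proof -
  have "inj ((*v) (S + t *\<^sub>R mat 1))"
  proof (rule injI)
    fix x y
    assume "(S + t *\<^sub>R mat 1) *v x = (S + t *\<^sub>R mat 1) *v y"
    then have "(m + t) * norm (x - y) \<le> 0"
      using resolvent_norm_vector[OF assms, of "x - y"] by (simp add: matrix_vector_mult.diff_right)
    then show "x = y"
      using m t by (simp add: mult_le_0_iff)
  qed
  then obtain B where B: "B ** (S + t *\<^sub>R mat 1) = mat 1"
    unfolding matrix_left_invertible_injective[symmetric] ..
  show inv: "resolvent S t ** (S + t *\<^sub>R mat 1) = mat 1"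
    unfolding resolvent_def matrix_inv_eqI[OF B] by (rule B)
  show "(S + t *\<^sub>R mat 1) ** resolvent S t = mat 1"
    by (rule matrix_left_right_inverse1[OF inv])
qed

text \<open>The matrix norm is the Euclidean norm of the entries, hence at most their absolute sum;
  each entry is controlled by applying the resolvent to a unit vector. The dimensional factor is
  crude but harmless for domination.\<close>

lemma norm_resolvent_le:
  fixes S :: "complex^'n^'n"
  assumes S: "coercive m S" and m: "0 < m" and t: "0 \<le> t"
  shows "norm (resolvent S t) \<le> (CARD('n))\<^sup>2 / (m + t)"
proof -
  have entry: "norm (resolvent S t $ i $ j) \<le> 1 / (m + t)" for i j
  proof -
    let ?x = "resolvent S t *v axis j 1"
    have "(m + t) * norm ?x \<le> norm ((S + t *\<^sub>R mat 1) *v ?x)"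
      by (rule resolvent_norm_vector[OF assms])
    also have "\<dots> = norm (axis j (1::complex))"
      by (simp only: matrix_vector_mul_assoc resolvent_inverse[OF assms] matrix_vector_mul_lid)
    also have "\<dots> = 1"
      by (simp add: norm_eq_sqrt_inner inner_axis_axis)
    finally have "norm ?x \<le> 1 / (m + t)"
      using m t by (simp add: field_simps)
    moreover have "resolvent S t $ i $ j = ?x $ i"
      by (simp add: matrix_vector_mult_def axis_def if_distrib cong: if_cong)
    moreover have "norm (?x $ i) \<le> norm ?x"
      by (rule Finite_Cartesian_Product.norm_nth_le)
    ultimately show ?thesis
      by simp
  qed
  have "norm (resolvent S t) \<le> (\<Sum>i\<in>UNIV. norm (resolvent S t $ i))"
    unfolding norm_vec_def by (rule L2_set_le_sum) simp
  also have "\<dots> \<le> (\<Sum>i\<in>UNIV. \<Sum>j\<in>UNIV. norm (resolvent S t $ i $ j))"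
    by (intro sum_mono) (simp add: norm_vec_def[of "_ $ _"] L2_set_le_sum)
  also have "\<dots> \<le> (\<Sum>i\<in>(UNIV :: 'n set). \<Sum>j\<in>(UNIV :: 'n set). 1 / (m + t))"
    by (intro sum_mono entry)
  finally show ?thesis
    by (simp add: power2_eq_square)
qed

text \<open>Covers both uses: a fixed matrix with moving \<open>t\<close>, for measurability, and
  moving matrices with fixed \<open>t\<close>, for dominated convergence.\<close>

lemma tendsto_resolvent:
  fixes S :: "'a \<Rightarrow> complex^'n^'n"
  assumes S: "(S \<longlongrightarrow> L) F" and T: "(T \<longlongrightarrow> t) F" and "0 < m" and "\<forall>\<^sub>F n in F. coercive m (S n)" "coercive m L"
    and "\<forall>\<^sub>F n in F. 0 \<le> T n" and "0 \<le> t"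
  shows "((\<lambda>n. resolvent (S n) (T n)) \<longlongrightarrow> resolvent L t) F"
proof (rule tendsto_inverse_matrix)
  show "((\<lambda>n. S n + T n *\<^sub>R mat 1) \<longlongrightarrow> L + t *\<^sub>R mat 1) F"
    by (intro tendsto_intros S T)
  show "\<forall>\<^sub>F n in F. resolvent (S n) (T n) ** (S n + T n *\<^sub>R mat 1) = mat 1"
    using assms(4,6) by eventually_elim (rule resolvent_inverse[OF _ \<open>0 < m\<close>])
  show "(L + t *\<^sub>R mat 1) ** resolvent L t = mat 1"
    using assms by (intro resolvent_inverse)
  show "\<forall>\<^sub>F n in F. norm (resolvent (S n) (T n)) \<le> (CARD('n))\<^sup>2 / m"
    using assms(4,6)
  proof eventually_elim
    case (elim n)
    then have "norm (resolvent (S n) (T n)) \<le> (CARD('n))\<^sup>2 / (m + T n)"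
      using \<open>0 < m\<close> by (intro norm_resolvent_le)
    also have "\<dots> \<le> (CARD('n))\<^sup>2 / m"
      using elim \<open>0 < m\<close> by (intro divide_left_mono) auto
    finally show ?case .
  qed
qed

lemma continuous_on_resolvent:
  assumes "coercive m S" "0 < m"
  shows "continuous_on {0<..} (resolvent S)"
  unfolding continuous_on_def
proof
  fix t :: real assume "t \<in> {0<..}"
  moreover have "\<forall>\<^sub>F s in at t within {0<..}. 0 \<le> s"
    by (auto simp: eventually_at_filter)
  ultimately show "(resolvent S \<longlongrightarrow> resolvent S t) (at t within {0<..})"
    using assms by (intro tendsto_resolvent[where m = m and S = "\<lambda>_. S"]) auto
qed

section \<open>Matrix powers and their derivative\<close>

text \<open>With a unitary \<open>U\<close> fixed, this is multiplicative and linear in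
  \<open>e\<close>, so identities between functions of one matrix reduce to scalar identities for
  its eigenvalues.\<close>

definition spectral :: "complex^'n^'n \<Rightarrow> ('n \<Rightarrow> real) \<Rightarrow> complex^'n^'n" where
  "spectral U e = U ** real_diag e ** cadjoint U"

lemma spectral_mult:
  assumes "unitary_matrix U"
  shows "spectral U e ** spectral U e' = spectral U (\<lambda>i. e i * e' i)"
proof -
  have "real_diag e ** real_diag e' = real_diag (\<lambda>i. e i * e' i)"
    by (simp add: vec_eq_iff real_diag_mult_nth) (simp add: real_diag_def)
  then have "U ** real_diag (\<lambda>i. e i * e' i) ** cadjoint U
      = U ** real_diag e ** real_diag e' ** cadjoint U"
    by (metis matrix_mul_assoc)
  moreover have "spectral U e ** spectral U e'
      = U ** real_diag e ** (cadjoint U ** U) ** real_diag e' ** cadjoint U"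
    by (simp only: spectral_def matrix_mul_assoc)
  ultimately show ?thesis
    using assms by (simp add: spectral_def unitary_matrix_def)
qed

lemma spectral_one:
  fixes U :: "complex^'n^'n"
  assumes "unitary_matrix U"
  shows "spectral U (\<lambda>_. 1) = mat 1"
proof -
  have "real_diag (\<lambda>_ :: 'n. 1) = mat 1"
    by (simp add: vec_eq_iff real_diag_def mat_def)
  then show ?thesis
    using assms by (simp add: spectral_def unitary_matrix_def)
qed

text \<open>Stated over the Euclidean space \<open>real^'n\<close>, where linear maps are bounded
  and hence commute with Bochner integrals.\<close>

lemma linear_spectral: "linear (\<lambda>e :: real^'n. spectral U (\<lambda>i. e $ i))"
proof (rule linearI)
  have "real_diag (\<lambda>i. (x + y) $ i) = real_diag (\<lambda>i. x $ i) + real_diag (\<lambda>i. y $ i)" for x y :: "real^'n"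
    by (simp add: vec_eq_iff real_diag_def)
  then show "spectral U (\<lambda>i. (x + y) $ i) = spectral U (\<lambda>i. x $ i) + spectral U (\<lambda>i. y $ i)" for x y
    by (simp only: spectral_def matrix_mult.add_left matrix_mult.add_right)
  have "real_diag (\<lambda>i. (r *\<^sub>R x) $ i) = r *\<^sub>R real_diag (\<lambda>i. x $ i)" for r and x :: "real^'n"
    by (simp add: vec_eq_iff real_diag_def complex_eq_iff)
  then show "spectral U (\<lambda>i. (r *\<^sub>R x) $ i) = r *\<^sub>R spectral U (\<lambda>i. x $ i)" for r x
    by (simp only: spectral_def matrix_mult.scaleR_left matrix_mult.scaleR_right)
qed

lemma spectral_diff: "spectral U e - spectral U e' = spectral U (\<lambda>i. e i - e' i)"
  using linear_diff[OF linear_spectral, of U "\<chi> i. e i" "\<chi> i. e' i"] by simp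

lemma spectral_scaleR: "r *\<^sub>R spectral U e = spectral U (\<lambda>i. r * e i)"
  using linear_cmul[OF linear_spectral, of U r "\<chi> i. e i"] by simp

lemma has_bochner_integral_vec:
  fixes f :: "'a \<Rightarrow> real^'n"
  assumes "\<And>i. has_bochner_integral M (\<lambda>t. f t $ i) (c $ i)"
  shows "has_bochner_integral M f c"
proof -
  have "has_bochner_integral M (\<lambda>t. \<Sum>i\<in>UNIV. (f t $ i) *\<^sub>R (axis i 1 :: real^'n)) (\<Sum>i\<in>UNIV. (c $ i) *\<^sub>R axis i 1)"
    using assms by (intro has_bochner_integral_sum has_bochner_integral_scaleR_left) auto
  moreover have "(\<Sum>i\<in>UNIV. (x $ i) *\<^sub>R axis i 1) = x" for x :: "real^'n"
    by (simp add: vec_eq_iff axis_def mult_delta_right)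
  ultimately show ?thesis
    by simp
qed

lemma has_bochner_integral_spectral:
  assumes "\<And>i. has_bochner_integral M (\<lambda>t. indicator A t *\<^sub>R e t i) (c i)"
  shows "has_bochner_integral M (\<lambda>t. indicator A t *\<^sub>R spectral U (e t)) (spectral U c)"
proof -
  have "has_bochner_integral M (\<lambda>t. \<chi> i. indicator A t * e t i) (\<chi> i. c i)"
    by (rule has_bochner_integral_vec) (use assms in simp)
  from has_bochner_integral_bounded_linear[OF linear_linear[THEN iffD2, OF linear_spectral, of U] this]
  show ?thesis
    by (simp add: spectral_scaleR)
qed

lemma positive_definite_spectral:
  assumes "positive_definite S"
  obtains U d where "unitary_matrix U" "S = spectral U d" "\<And>i. 0 < d i"
proof -
  obtain U d where U: "unitary_matrix U" and S: "S = spectral U d"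
    using assms hermitian_spectral_decomposition unfolding positive_definite_def spectral_def by metis
  have "0 < d i" for i
  proof -
    \<comment> \<open>The quadratic form of \<open>S\<close> at the \<open>i\<close>-th column of
      \<open>U\<close> is the eigenvalue \<open>d i\<close>.\<close>
    define x where "x = U *v axis i 1"
    have UUx: "cadjoint U *v x = axis i 1"
      using U by (simp add: x_def matrix_vector_mul_assoc unitary_matrix_def)
    then have "x \<noteq> 0"
      by auto
    then have "0 < Re (cinner x (S *v x))"
      using assms by (simp add: positive_definite_def)
    also have "cinner x (S *v x) = cinner (cadjoint U *v x) (real_diag d *v (cadjoint U *v x))"
      by (simp add: S spectral_def cinner_adjoint flip: matrix_vector_mul_assoc)
    also have "\<dots> = d i"
      unfolding UUx
      by (simp add: cinner_def matrix_vector_mult_def real_diag_def axis_def mult_delta_left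
          mult_delta_right if_distrib[of cnj])
    finally show ?thesis by simp
  qed
  then show thesis
    using U S that by blast
qed

lemma matrix_powr_spectral:
  "unitary_matrix U \<Longrightarrow> matrix_powr (spectral U d) p = spectral U (\<lambda>i. d i powr p)"
  by (simp add: matrix_powr_def spectral_def matrix_fun_eq)

lemma resolvent_spectral:
  assumes U: "unitary_matrix U" and d: "\<And>i. 0 < d i" and t: "0 \<le> t"
  shows "resolvent (spectral U d) t = spectral U (\<lambda>i. 1 / (d i + t))"
proof -
  have "1 / (d i + t) * d i + t * (1 / (d i + t)) = 1" for i
    using add_pos_nonneg[OF d[of i] t] by (simp flip: add_divide_distrib)
  moreover have "spectral U e + spectral U e' = spectral U (\<lambda>i. e i + e' i)" for e e'
    using linear_add[OF linear_spectral, of U "\<chi> i. e i" "\<chi> i. e' i"] by simp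
  ultimately have "spectral U (\<lambda>i. 1 / (d i + t)) ** (spectral U d + t *\<^sub>R mat 1) = mat 1"
    using U by (simp add: matrix_mult.add_right matrix_mult.scaleR_right spectral_mult
        spectral_scaleR spectral_one)
  then show ?thesis
    unfolding resolvent_def by (rule matrix_inv_eqI)
qed

text \<open>The scalar representation, applied to every eigenvalue in a common eigenbasis.\<close>

lemma has_bochner_integral_matrix_powr:
  assumes S: "positive_definite S" and p: "0 < p" "p < 1"
  shows "has_bochner_integral lborel
    (\<lambda>t. indicator {0<..} t *\<^sub>R (t powr p *\<^sub>R ((1 / t) *\<^sub>R mat 1 - resolvent S t)))
    ((pi / sin (p * pi)) *\<^sub>R matrix_powr S p)"
proof -
  obtain U d where U: "unitary_matrix U" and S: "S = spectral U d" and d: "\<And>i. 0 < d i"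
    using positive_definite_spectral[OF S] by metis
  have "has_bochner_integral lborel
      (\<lambda>t. indicator {0<..} t *\<^sub>R spectral U (\<lambda>i. t powr p * (1 / t - 1 / (d i + t))))
      (spectral U (\<lambda>i. pi / sin (p * pi) * d i powr p))"
    by (intro has_bochner_integral_spectral powr_integral_representation p d)
  moreover have "indicator {0<..} t *\<^sub>R spectral U (\<lambda>i. t powr p * (1 / t - 1 / (d i + t)))
      = indicator {0<..} t *\<^sub>R (t powr p *\<^sub>R ((1 / t) *\<^sub>R mat 1 - resolvent S t))" for t
  proof (cases "0 < t")
    case True
    then show ?thesis
      by (simp only: S resolvent_spectral[OF U d less_imp_le] spectral_one[OF U, symmetric]
          spectral_scaleR spectral_diff) simp
  qed simp
  ultimately show ?thesis
    by (simp add: S matrix_powr_spectral[OF U] spectral_scaleR)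
qed

text \<open>The double operator integral of the divided difference of \<open>x \<mapsto> x powr p\<close>; on the diagonal
  \<open>S = T\<close> it is the Frechet derivative of the matrix power.\<close>

definition powr_quotient :: "real \<Rightarrow> complex^'n^'n \<Rightarrow> complex^'n^'n \<Rightarrow> complex^'n^'n \<Rightarrow> complex^'n^'n" where
  "powr_quotient p S T Z = (sin (p * pi) / pi) *\<^sub>R
     (LINT t:{0<..}|lborel. t powr p *\<^sub>R (resolvent S t ** Z ** resolvent T t))"

lemma sin_pos: "0 < p \<Longrightarrow> p < 1 \<Longrightarrow> 0 < sin (p * pi)"
  by (intro sin_gt_zero) auto

text \<open>In the difference of the two integral representations the terms with
  \<open>1 / t\<close> cancel, and the resolvent identity rewrites the difference of resolvents. The
  formula is exact, and \<open>S\<close> and \<open>T\<close> may fail to commute.\<close>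

lemma matrix_powr_diff:
  assumes S: "positive_definite S" and T: "positive_definite T" and p: "0 < p" "p < 1"
  shows "matrix_powr T p - matrix_powr S p = powr_quotient p S T (T - S)"
proof -
  obtain m where m: "0 < m" "coercive m S"
    using positive_definite_coercive[OF S] .
  obtain m' where m': "0 < m'" "coercive m' T"
    using positive_definite_coercive[OF T] .
  have "has_bochner_integral lborel
     (\<lambda>t. indicator {0<..} t *\<^sub>R (t powr p *\<^sub>R ((1 / t) *\<^sub>R mat 1 - resolvent T t)) -
        indicator {0<..} t *\<^sub>R (t powr p *\<^sub>R ((1 / t) *\<^sub>R mat 1 - resolvent S t)))
     ((pi / sin (p * pi)) *\<^sub>R matrix_powr T p - (pi / sin (p * pi)) *\<^sub>R matrix_powr S p)"
    by (intro has_bochner_integral_diff has_bochner_integral_matrix_powr S T p)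
  also have "(\<lambda>t. indicator {0<..} t *\<^sub>R (t powr p *\<^sub>R ((1 / t) *\<^sub>R mat 1 - resolvent T t)) -
        indicator {0<..} t *\<^sub>R (t powr p *\<^sub>R ((1 / t) *\<^sub>R mat 1 - resolvent S t)))
      = (\<lambda>t. indicator {0<..} t *\<^sub>R (t powr p *\<^sub>R (resolvent S t ** (T - S) ** resolvent T t)))"
  proof
    fix t :: real
    show "indicator {0<..} t *\<^sub>R (t powr p *\<^sub>R ((1 / t) *\<^sub>R mat 1 - resolvent T t)) -
        indicator {0<..} t *\<^sub>R (t powr p *\<^sub>R ((1 / t) *\<^sub>R mat 1 - resolvent S t))
      = indicator {0<..} t *\<^sub>R (t powr p *\<^sub>R (resolvent S t ** (T - S) ** resolvent T t))"
    proof (cases "0 < t")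
      case True
      then have "resolvent S t - resolvent T t
          = resolvent S t ** (T + t *\<^sub>R mat 1 - (S + t *\<^sub>R mat 1)) ** resolvent T t"
        by (intro inverse_matrix_diff resolvent_inverse[OF m(2,1)] resolvent_inverse[OF m'(2,1)])
          auto
      then show ?thesis
        using True by (simp flip: scaleR_diff_right)
    qed simp
  qed
  finally show ?thesis
    using sin_pos[OF p]
    by (simp add: powr_quotient_def set_lebesgue_integral_def has_bochner_integral_iff
        flip: scaleR_diff_right)
qed

section \<open>Domination and continuity of the double operator integral\<close>

text \<open>The constant depends on the dimension alone, so one bound serves all members of a
  sequence. It is stated as an existence claim because it contains the unnamed constant of the
  matrix product.\<close>

lemma resolvent_sandwich_bound:
  "\<exists>C\<ge>0. \<forall>m (S :: complex^'n^'n) T (Z :: complex^'n^'n) t.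
    0 < m \<longrightarrow> coercive m S \<longrightarrow> coercive m T \<longrightarrow> 0 < t \<longrightarrow>
    norm (resolvent S t ** Z ** resolvent T t) \<le> C * norm Z / (m + t)\<^sup>2"
proof -
  obtain K where K: "0 < K" "\<And>A B. norm (A ** B) \<le> norm (A :: complex^'n^'n) * norm (B :: complex^'n^'n) * K"
    using matrix_mult.pos_bounded by blast
  let ?N = "real ((CARD('n))\<^sup>2)"
  have "norm (resolvent S t ** Z ** resolvent T t) \<le> (?N * ?N * K * K) * norm Z / (m + t)\<^sup>2"
    if m: "0 < m" and S: "coercive m S" and T: "coercive m T" and t: "0 < t"
    for m t and S T Z :: "complex^'n^'n"
  proof -
    have "norm (resolvent S t ** Z ** resolvent T t)
        \<le> norm (resolvent S t ** Z) * norm (resolvent T t) * K"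
      by (rule K)
    also have "\<dots> \<le> (norm (resolvent S t) * norm Z * K) * norm (resolvent T t) * K"
      using K by (intro mult_right_mono) auto
    also have "\<dots> \<le> (?N / (m + t) * norm Z * K) * (?N / (m + t)) * K"
      using K m t by (intro mult_right_mono mult_mono norm_resolvent_le S T) auto
    finally show ?thesis
      by (simp add: power2_eq_square mult_ac)
  qed
  moreover have "0 \<le> ?N * ?N * K * K"
    using K by simp
  ultimately show ?thesis
    by (intro exI[of _ "?N * ?N * K * K"]) simp
qed

lemma borel_measurable_resolvent_sandwich:
  fixes S T Z :: "complex^'n^'n"
  assumes "positive_definite S" and "positive_definite T"
  shows "(\<lambda>t. indicator {0<..} t *\<^sub>R (t powr p *\<^sub>R (resolvent S t ** Z ** resolvent T t)))
    \<in> borel_measurable lborel"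
proof -
  have cont: "continuous_on {0<..} (resolvent A)" if "positive_definite A" for A :: "complex^'n^'n"
    using positive_definite_coercive[OF that] continuous_on_resolvent by metis
  have "continuous_on {0<..} (\<lambda>t::real. t powr p *\<^sub>R (resolvent S t ** Z ** resolvent T t))"
    by (intro continuous_intros matrix_mult.continuous_on cont assms) auto
  then show ?thesis
    by (subst measurable_lborel2) (intro borel_measurable_continuous_on_indicator, simp)
qed

lemma integrable_powr_over_square:
  fixes m p :: real
  assumes "0 < p" "p < 1" "0 < m"
  shows "integrable lborel (\<lambda>t. indicator {0<..} t *\<^sub>R (t powr p / (m + t)\<^sup>2))"
  using powr_deriv_integral_representation[OF assms] by (simp add: has_bochner_integral_iff)

lemma integrable_resolvent_sandwich:
  fixes S T Z :: "complex^'n^'n"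
  assumes S: "positive_definite S" and T: "positive_definite T" and p: "0 < p" "p < 1"
  shows "integrable lborel
    (\<lambda>t. indicator {0<..} t *\<^sub>R (t powr p *\<^sub>R (resolvent S t ** Z ** resolvent T t)))"
proof -
  obtain C where C: "\<And>m S T (Z :: complex^'n^'n) t. 0 < m \<Longrightarrow> coercive m S \<Longrightarrow> coercive m T \<Longrightarrow> 0 < t \<Longrightarrow>
      norm (resolvent S t ** Z ** resolvent T t) \<le> C * norm Z / (m + t)\<^sup>2"
    using resolvent_sandwich_bound by blast
  obtain m1 m2 where "0 < m1" "coercive m1 S" "0 < m2" "coercive m2 T"
    using positive_definite_coercive[OF S] positive_definite_coercive[OF T] by metis
  then have m: "0 < min m1 m2" and co: "coercive (min m1 m2) S" "coercive (min m1 m2) T"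
    by (auto intro: coercive_mono)
  show ?thesis
  proof (rule Bochner_Integration.integrable_bound)
    show "integrable lborel (\<lambda>t. (C * norm Z) * (indicator {0<..} t *\<^sub>R (t powr p / (min m1 m2 + t)\<^sup>2)))"
      by (intro integrable_mult_right integrable_powr_over_square p m)
    have "norm (indicator {0<..} t *\<^sub>R (t powr p *\<^sub>R (resolvent S t ** Z ** resolvent T t)))
        \<le> (C * norm Z) * (indicator {0<..} t *\<^sub>R (t powr p / (min m1 m2 + t)\<^sup>2))" for t
      using mult_left_mono[OF C[OF m co, of t Z], of "t powr p"]
      by (cases "0 < t") (simp_all add: mult_ac)
    then show "AE t in lborel. norm (indicator {0<..} t *\<^sub>R (t powr p *\<^sub>R (resolvent S t ** Z ** resolvent T t)))
        \<le> norm ((C * norm Z) * (indicator {0<..} t *\<^sub>R (t powr p / (min m1 m2 + t)\<^sup>2)))"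
      unfolding real_norm_def by (intro AE_I2 order_trans[OF _ abs_ge_self])
  qed (rule borel_measurable_resolvent_sandwich[OF S T])
qed

text \<open>Dominated convergence: the resolvents converge pointwise, and a common coercivity
  constant gives a common integrable bound.\<close>

lemma LIMSEQ_powr_quotient:
  fixes S T Z :: "nat \<Rightarrow> complex^'n^'n"
  assumes S: "S \<longlonglongrightarrow> S0" and T: "T \<longlonglongrightarrow> T0" and Z: "Z \<longlonglongrightarrow> Z0"
    and pd: "\<And>n. positive_definite (S n)" "\<And>n. positive_definite (T n)"
      "positive_definite S0" "positive_definite T0"
    and p: "0 < p" "p < 1"
  shows "(\<lambda>n. powr_quotient p (S n) (T n) (Z n)) \<longlonglongrightarrow> powr_quotient p S0 T0 Z0"
proof -
  obtain C where C_nonneg: "0 \<le> C" and C: "\<And>m S T (Z :: complex^'n^'n) t. 0 < m \<Longrightarrow> coercive m S \<Longrightarrow> coercive m T \<Longrightarrow> 0 < t \<Longrightarrow>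
      norm (resolvent S t ** Z ** resolvent T t) \<le> C * norm Z / (m + t)\<^sup>2"
    using resolvent_sandwich_bound by blast
  obtain m1 m2 where "0 < m1" "coercive m1 S0" "0 < m2" "coercive m2 T0"
    using positive_definite_coercive[OF pd(3)] positive_definite_coercive[OF pd(4)] by metis
  then have min: "0 < min m1 m2" "coercive (min m1 m2) S0" "coercive (min m1 m2) T0"
    by (auto intro: coercive_mono)
  \<comment> \<open>Halving the constant of the limits makes it valid for all large \<open>n\<close>
    as well.\<close>
  define m where "m = min m1 m2 / 2"
  have m: "0 < m" and S0: "coercive m S0" and T0: "coercive m T0"
    using min by (auto simp: m_def elim!: coercive_mono)
  have Sn: "\<forall>\<^sub>F n in sequentially. coercive m (S n)" and Tn: "\<forall>\<^sub>F n in sequentially. coercive m (T n)"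
    unfolding m_def using min by (auto intro: eventually_coercive[OF S] eventually_coercive[OF T])
  have "\<forall>\<^sub>F n in sequentially. norm (Z n) < norm Z0 + 1"
    using tendsto_norm[OF Z] by (rule order_tendstoD) simp
  with Sn Tn have "\<forall>\<^sub>F n in sequentially. coercive m (S n) \<and> coercive m (T n) \<and> norm (Z n) < norm Z0 + 1"
    by (simp add: eventually_conj_iff)
  \<comment> \<open>The domination is required for every index, hence the shift by \<open>N\<close>,
    which \<open>LIMSEQ_offset\<close> undoes at the end.\<close>
  then obtain N where N: "\<And>n. N \<le> n \<Longrightarrow> coercive m (S n)" "\<And>n. N \<le> n \<Longrightarrow> coercive m (T n)"
      "\<And>n. N \<le> n \<Longrightarrow> norm (Z n) < norm Z0 + 1"
    by (auto simp: eventually_sequentially)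
  let ?f = "\<lambda>S T Z t. indicator {0<..} t *\<^sub>R (t powr p *\<^sub>R (resolvent S t ** Z ** resolvent T t))"
  have "(\<lambda>n. integral\<^sup>L lborel (?f (S (n + N)) (T (n + N)) (Z (n + N)))) \<longlonglongrightarrow> integral\<^sup>L lborel (?f S0 T0 Z0)"
  proof (rule integral_dominated_convergence)
    show "integrable lborel (\<lambda>t. (C * (norm Z0 + 1)) * (indicator {0<..} t *\<^sub>R (t powr p / (m + t)\<^sup>2)))"
      by (intro integrable_mult_right integrable_powr_over_square p m)
    show "?f S0 T0 Z0 \<in> borel_measurable lborel"
      by (intro borel_measurable_resolvent_sandwich pd)
    show "?f (S (n + N)) (T (n + N)) (Z (n + N)) \<in> borel_measurable lborel" for n
      by (intro borel_measurable_resolvent_sandwich pd)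
    have "(\<lambda>n. ?f (S (n + N)) (T (n + N)) (Z (n + N)) t) \<longlonglongrightarrow> ?f S0 T0 Z0 t" for t
    proof (cases "0 < t")
      case True
      have "(\<lambda>n. resolvent (S (n + N)) t) \<longlonglongrightarrow> resolvent S0 t"
        by (rule tendsto_resolvent[OF LIMSEQ_ignore_initial_segment[OF S] tendsto_const m])
          (use N S0 True in auto)
      moreover have "(\<lambda>n. resolvent (T (n + N)) t) \<longlonglongrightarrow> resolvent T0 t"
        by (rule tendsto_resolvent[OF LIMSEQ_ignore_initial_segment[OF T] tendsto_const m])
          (use N T0 True in auto)
      ultimately show ?thesis
        by (intro tendsto_intros matrix_mult.tendsto LIMSEQ_ignore_initial_segment[OF Z])
    qed simp
    then show "AE t in lborel. (\<lambda>n. ?f (S (n + N)) (T (n + N)) (Z (n + N)) t) \<longlonglongrightarrow> ?f S0 T0 Z0 t"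
      by simp
    have "norm (?f (S (n + N)) (T (n + N)) (Z (n + N)) t)
        \<le> (C * (norm Z0 + 1)) * (indicator {0<..} t *\<^sub>R (t powr p / (m + t)\<^sup>2))" for n t
    proof (cases "0 < t")
      case True
      have "norm (resolvent (S (n + N)) t ** Z (n + N) ** resolvent (T (n + N)) t)
          \<le> C * norm (Z (n + N)) / (m + t)\<^sup>2"
        using N True by (intro C m) auto
      also have "\<dots> \<le> C * (norm Z0 + 1) / (m + t)\<^sup>2"
        using N(3)[of "n + N"] C_nonneg by (intro divide_right_mono mult_left_mono) auto
      finally have "t powr p * norm (resolvent (S (n + N)) t ** Z (n + N) ** resolvent (T (n + N)) t)
          \<le> t powr p * (C * (norm Z0 + 1) / (m + t)\<^sup>2)"
        by (rule mult_left_mono) simp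
      then show ?thesis
        using True by (simp add: mult_ac)
    qed simp
    then show "AE t in lborel. norm (?f (S (n + N)) (T (n + N)) (Z (n + N)) t)
        \<le> (C * (norm Z0 + 1)) * (indicator {0<..} t *\<^sub>R (t powr p / (m + t)\<^sup>2))" for n
      by simp
  qed
  then have "(\<lambda>n. powr_quotient p (S (n + N)) (T (n + N)) (Z (n + N))) \<longlonglongrightarrow> powr_quotient p S0 T0 Z0"
    unfolding powr_quotient_def set_lebesgue_integral_def by (intro tendsto_intros)
  then show ?thesis
    by (rule LIMSEQ_offset)
qed

lemma tendsto_powr_quotient:
  fixes S T Z :: "real \<Rightarrow> complex^'n^'n"
  assumes "(S \<longlongrightarrow> S0) (at a)" "(T \<longlongrightarrow> T0) (at a)" "(Z \<longlongrightarrow> Z0) (at a)"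
    and "\<And>h. positive_definite (S h)" "\<And>h. positive_definite (T h)"
      "positive_definite S0" "positive_definite T0"
    and "0 < p" "p < 1"
  shows "((\<lambda>h. powr_quotient p (S h) (T h) (Z h)) \<longlongrightarrow> powr_quotient p S0 T0 Z0) (at a)"
  using assms unfolding tendsto_at_iff_sequentially comp_def by (intro allI impI LIMSEQ_powr_quotient) auto

lemma powr_quotient_scaleR: "powr_quotient p S T (r *\<^sub>R Z) = r *\<^sub>R powr_quotient p S T Z"
  by (simp only: powr_quotient_def matrix_mult.scaleR_left matrix_mult.scaleR_right
      scaleR_left_commute[of _ r] set_integral_scaleR_right)

section \<open>The derivative of the matrix power\<close>

lemma has_vector_derivative_iff_quotient:
  "(f has_vector_derivative D) (at a) \<longleftrightarrow> ((\<lambda>t. (1 / (t - a)) *\<^sub>R (f t - f a)) \<longlongrightarrow> D) (at a)"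
proof -
  have "norm (f t - f a - (t - a) *\<^sub>R D) / norm (t - a) = norm ((1 / (t - a)) *\<^sub>R (f t - f a) - D)"
    if "t \<noteq> a" for t
  proof -
    have "(1 / (t - a)) *\<^sub>R (f t - f a) - D = (1 / (t - a)) *\<^sub>R (f t - f a - (t - a) *\<^sub>R D)"
      using that by (simp add: scaleR_diff_right)
    then show ?thesis
      by simp
  qed
  then have "((\<lambda>t. norm (f t - f a - (t - a) *\<^sub>R D) / norm (t - a)) \<longlongrightarrow> 0) (at a)
      \<longleftrightarrow> ((\<lambda>t. norm ((1 / (t - a)) *\<^sub>R (f t - f a) - D)) \<longlongrightarrow> 0) (at a)"
    by (intro filterlim_cong refl) (auto simp: eventually_at_filter)
  then show ?thesis
    by (simp add: has_vector_derivative_def has_derivative_iff_norm bounded_linear_scaleR_left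
        tendsto_norm_zero_iff LIM_zero_iff)
qed

text \<open>By the exact difference formula the difference quotient of the power is
  \<open>powr_quotient\<close> evaluated at the difference quotient of \<open>S\<close>; joint
  continuity gives the limit.\<close>

lemma has_vector_derivative_matrix_powr:
  fixes S :: "real \<Rightarrow> complex^'n^'n"
  assumes S: "(S has_vector_derivative D) (at a)" and pd: "\<And>t. positive_definite (S t)"
    and p: "0 < p" "p < 1"
  shows "((\<lambda>t. matrix_powr (S t) p) has_vector_derivative powr_quotient p (S a) (S a) D) (at a)"
  unfolding has_vector_derivative_iff_quotient
proof -
  have "(S \<longlongrightarrow> S a) (at a)"
    using has_vector_derivative_continuous[OF S] by (simp add: continuous_at)
  then have "((\<lambda>t. powr_quotient p (S a) (S t) ((1 / (t - a)) *\<^sub>R (S t - S a)))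
      \<longlongrightarrow> powr_quotient p (S a) (S a) D) (at a)"
    using S by (intro tendsto_powr_quotient pd p) (simp_all add: has_vector_derivative_iff_quotient)
  then show "((\<lambda>t. (1 / (t - a)) *\<^sub>R (matrix_powr (S t) p - matrix_powr (S a) p))
      \<longlongrightarrow> powr_quotient p (S a) (S a) D) (at a)"
    by (simp add: powr_quotient_scaleR matrix_powr_diff[OF pd pd p])
qed

lemma bounded_linear_trace_mult:
  "bounded_linear (\<lambda>A. trace (A ** B))" "bounded_linear (\<lambda>A. trace (B ** A))"
  for B :: "complex^'n^'n"
  using linear_conv_bounded_linear linear_trace
  by (blast intro: bounded_linear_compose[OF _ matrix_mult.bounded_linear_left]
      bounded_linear_compose[OF _ matrix_mult.bounded_linear_right])+

text \<open>Up to the factor \<open>pi / sin (p * pi)\<close> the integral of \<open>t powr p\<close> times the squared resolvent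
  is \<open>p\<close> times the power \<open>p - 1\<close> of \<open>S\<close>, which cancels the outer power.\<close>

lemma trace_matrix_powr_mult_powr_quotient:
  fixes S Y :: "complex^'n^'n"
  assumes S: "positive_definite S" and p: "0 < p" "p < 1"
  shows "trace (matrix_powr S (1 - p) ** powr_quotient p S S Y) = complex_of_real p * trace Y"
proof -
  obtain U d where U: "unitary_matrix U" and Sd: "S = spectral U d" and d: "\<And>i. 0 < d i"
    using positive_definite_spectral[OF S] by metis
  let ?P = "matrix_powr S (1 - p)"
  let ?k = "\<lambda>t. t powr p *\<^sub>R (resolvent S t ** Y ** resolvent S t)"
  \<comment> \<open>\<open>?g t\<close> is \<open>t powr p\<close> times the product of resolvent,
    \<open>?P\<close> and resolvent, written in the eigenbasis of \<open>S\<close>. Under the trace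
    with \<open>Y\<close>, cyclicity makes it equivalent to \<open>?P ** ?k t\<close>.\<close>
  let ?g = "\<lambda>t. spectral U (\<lambda>i. d i powr (1 - p) * (t powr p / (d i + t)\<^sup>2))"
  let ?c = "pi / sin (p * pi)"
  have "has_bochner_integral lborel (\<lambda>t. indicator {0<..} t *\<^sub>R ?g t)
      (spectral U (\<lambda>i. d i powr (1 - p) * (?c * (p * d i powr (p - 1)))))"
  proof (rule has_bochner_integral_spectral)
    fix i
    show "has_bochner_integral lborel (\<lambda>t. indicator {0<..} t *\<^sub>R (d i powr (1 - p) * (t powr p / (d i + t)\<^sup>2)))
        (d i powr (1 - p) * (?c * (p * d i powr (p - 1))))"
      using has_bochner_integral_mult_right[OF powr_deriv_integral_representation[OF p d[of i]],
          of "d i powr (1 - p)"]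
      by (simp add: mult_ac)
  qed
  \<comment> \<open>The eigenvalues drop out, so the integral is a multiple of the identity.\<close>
  also have "(\<lambda>i. d i powr (1 - p) * (?c * (p * d i powr (p - 1)))) = (\<lambda>i. (?c * p) * 1)"
  proof
    fix i
    have "d i powr (1 - p) * d i powr (p - 1) = 1"
      using d[of i] by (simp flip: powr_add)
    then show "d i powr (1 - p) * (?c * (p * d i powr (p - 1))) = (?c * p) * 1"
      by simp
  qed
  also have "spectral U (\<lambda>i. (?c * p) * 1) = (?c * p) *\<^sub>R mat 1"
    by (simp only: spectral_one[OF U, symmetric] spectral_scaleR)
  finally have "has_bochner_integral lborel (\<lambda>t. trace ((indicator {0<..} t *\<^sub>R ?g t) ** Y))
      (trace (((?c * p) *\<^sub>R mat 1) ** Y))"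
    by (rule has_bochner_integral_bounded_linear[OF bounded_linear_trace_mult(1)])
  also have "(\<lambda>t. trace ((indicator {0<..} t *\<^sub>R ?g t) ** Y))
      = (\<lambda>t. trace (?P ** (indicator {0<..} t *\<^sub>R ?k t)))"
  proof
    fix t :: real
    show "trace ((indicator {0<..} t *\<^sub>R ?g t) ** Y) = trace (?P ** (indicator {0<..} t *\<^sub>R ?k t))"
    proof (cases "0 < t")
      case True
      have "?g t = t powr p *\<^sub>R (resolvent S t ** ?P ** resolvent S t)"
        using True
        by (simp add: Sd resolvent_spectral[OF U d] matrix_powr_spectral[OF U] spectral_mult[OF U]
            spectral_scaleR power2_eq_square mult_ac)
      moreover have "trace (resolvent S t ** ?P ** resolvent S t ** Y)
          = trace (?P ** (resolvent S t ** Y ** resolvent S t))"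
        using trace_mul_sym[of "resolvent S t" "?P ** resolvent S t ** Y"]
        by (simp only: matrix_mul_assoc)
      ultimately show ?thesis
        using True by (simp add: matrix_mult.scaleR_left matrix_mult.scaleR_right
            linear_cmul[OF linear_trace])
    qed simp
  qed
  finally have "integral\<^sup>L lborel (\<lambda>t. trace (?P ** (indicator {0<..} t *\<^sub>R ?k t)))
      = (?c * p) *\<^sub>R trace Y"
    by (simp add: has_bochner_integral_iff matrix_mult.scaleR_left linear_cmul[OF linear_trace])
  moreover have "integral\<^sup>L lborel (\<lambda>t. trace (?P ** (indicator {0<..} t *\<^sub>R ?k t)))
      = trace (?P ** (LINT t:{0<..}|lborel. ?k t))"
    unfolding set_lebesgue_integral_def
    by (rule integral_bounded_linear[OF bounded_linear_trace_mult(2)])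
      (rule integrable_resolvent_sandwich[OF S S p])
  ultimately have "trace (?P ** (LINT t:{0<..}|lborel. ?k t)) = (?c * p) *\<^sub>R trace Y"
    by simp
  then have "trace (?P ** powr_quotient p S S Y) = (sin (p * pi) / pi) *\<^sub>R ((?c * p) *\<^sub>R trace Y)"
    by (simp only: powr_quotient_def matrix_mult.scaleR_right linear_cmul[OF linear_trace])
  also have "\<dots> = p *\<^sub>R trace Y"
    using sin_pos[OF p] by simp
  finally show ?thesis
    by (simp add: scaleR_conv_of_real)
qed

section \<open>The information matrix\<close>

lemma hermitian_spectral: "hermitian_matrix (spectral U d)"
  by (simp add: hermitian_matrix_def spectral_def cadjoint_mult matrix_mul_assoc)

lemma hermitian_matrix_powr: "positive_definite S \<Longrightarrow> hermitian_matrix (matrix_powr S p)"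
  by (metis hermitian_spectral matrix_powr_spectral positive_definite_spectral)

text \<open>Taking adjoints is real-linear, so the adjoint of \<open>D\<close> is a derivative of
  the same curve; derivatives are unique.\<close>

lemma hermitian_vector_derivative:
  assumes "(f has_vector_derivative D) (at a)" and "\<And>t. hermitian_matrix (f t)"
  shows "hermitian_matrix D"
proof -
  have "((\<lambda>t. cadjoint (f t)) has_vector_derivative cadjoint D) (at a)"
    using assms(1) by (rule bounded_linear.has_vector_derivative[rotated])
      (simp add: linear_cadjoint flip: linear_conv_bounded_linear)
  then have "(f has_vector_derivative cadjoint D) (at a)"
    using assms(2) by (simp add: hermitian_matrix_def)
  then show ?thesis
    unfolding hermitian_matrix_def using assms(1) by (rule vector_derivative_unique_at)
qed

text \<open>Conjugation reverses the product and cyclicity restores it. This removes the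
  \<open>Re\<close> that the entropy introduces.\<close>

lemma trace_mult_hermitian_real:
  assumes "hermitian_matrix A" and "hermitian_matrix B"
  shows "trace (A ** B) = complex_of_real (Re (trace (A ** B)))"
proof -
  have "cnj (trace (A ** B)) = trace (cadjoint B ** cadjoint A)"
    by (simp flip: trace_cadjoint cadjoint_mult)
  also have "\<dots> = trace (A ** B)"
    using assms by (simp add: hermitian_matrix_def trace_mul_sym[of B])
  finally show ?thesis
    by (metis Reals_cnj_iff of_real_Re)
qed

lemma resolvent_commute:
  assumes "positive_definite S" and "0 \<le> s" and "0 \<le> t"
  shows "resolvent S s ** resolvent S t = resolvent S t ** resolvent S s"
proof -
  obtain U d where U: "unitary_matrix U" and S: "S = spectral U d" and d: "\<And>i. 0 < d i"
    using positive_definite_spectral[OF assms(1)] by metis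
  show ?thesis
    using assms by (simp add: S resolvent_spectral[OF U d] spectral_mult[OF U] mult.commute)
qed

text \<open>The exponents add up to 1. For a state the trace inside the logarithm is therefore 1 at
  the base point.\<close>

lemma trace_matrix_powr_mult_matrix_powr:
  assumes "positive_definite S"
  shows "trace (matrix_powr S p ** matrix_powr S (1 - p)) = trace S"
proof -
  obtain U d where U: "unitary_matrix U" and S: "S = spectral U d" and d: "\<And>i. 0 < d i"
    using positive_definite_spectral[OF assms(1)] by metis
  have "d i powr p * d i powr (1 - p) = d i" for i
    using d[of i] by (simp flip: powr_add)
  then show ?thesis
    by (simp add: S matrix_powr_spectral[OF U] spectral_mult[OF U])
qed

text \<open>As \<open>Z h\<close> is traceless, \<open>matrix_powr (S 0) p\<close> may be replaced by its difference to
  \<open>matrix_powr (S h) p\<close>.  That factor vanishes at \<open>h = 0\<close>, so of the other one only the continuity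
  is needed and no second derivative of the matrix power occurs.\<close>

lemma has_derivative_trace_powr_quotient:
  fixes S Z :: "real \<Rightarrow> complex^'n^'n"
  assumes S: "(S has_vector_derivative X) (at 0)" and Z: "(Z \<longlongrightarrow> Z 0) (at 0)"
    and pd: "\<And>h. positive_definite (S h)" and tr: "\<And>h. trace (Z h) = 0"
    and p: "0 < p" "p < 1"
  shows "((\<lambda>h. trace (matrix_powr (S 0) p ** powr_quotient (1 - p) (S h) (S h) (Z h)))
    has_vector_derivative
      - trace (powr_quotient p (S 0) (S 0) X ** powr_quotient (1 - p) (S 0) (S 0) (Z 0))) (at 0)"
  unfolding has_vector_derivative_iff_quotient
proof -
  let ?K = "\<lambda>h. powr_quotient (1 - p) (S h) (S h) (Z h)"
  have zero: "trace (matrix_powr (S h) p ** ?K h) = 0" for h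
    using trace_matrix_powr_mult_powr_quotient[OF pd, of "1 - p" h "Z h"] p by (simp add: tr)
  have S0: "(S \<longlongrightarrow> S 0) (at 0)"
    using has_vector_derivative_continuous[OF S] by (simp add: continuous_at)
  have "((\<lambda>h. (1 / (h - 0)) *\<^sub>R (matrix_powr (S h) p - matrix_powr (S 0) p))
      \<longlongrightarrow> powr_quotient p (S 0) (S 0) X) (at 0)"
    using has_vector_derivative_matrix_powr[OF S pd p] unfolding has_vector_derivative_iff_quotient .
  moreover have "(?K \<longlongrightarrow> ?K 0) (at 0)"
    using p by (intro tendsto_powr_quotient S0 Z pd) auto
  ultimately have "((\<lambda>h. - trace (((1 / (h - 0)) *\<^sub>R (matrix_powr (S h) p - matrix_powr (S 0) p)) ** ?K h))
      \<longlongrightarrow> - trace (powr_quotient p (S 0) (S 0) X ** ?K 0)) (at 0)"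
    by (intro tendsto_minus bounded_linear.tendsto[OF bounded_linear_trace] matrix_mult.tendsto)
  \<comment> \<open>Both \<open>trace (matrix_powr (S h) p ** ?K h)\<close> and its value at
    \<open>h = 0\<close> vanish by \<open>zero\<close>, so subtracting the former and dropping the
    latter turns one quotient into the other.\<close>
  then show "((\<lambda>h. (1 / (h - 0)) *\<^sub>R (trace (matrix_powr (S 0) p ** ?K h) - trace (matrix_powr (S 0) p ** ?K 0)))
      \<longlongrightarrow> - trace (powr_quotient p (S 0) (S 0) X ** ?K 0)) (at 0)"
    by (simp add: zero matrix_mult.scaleR_left matrix_mult.diff_left linear_cmul[OF linear_trace]
        linear_diff[OF linear_trace])
qed

section \<open>The double integral as a product of two single integrals\<close>

lemma integrable_pair_mult:
  fixes f g :: "real \<Rightarrow> complex"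
  assumes f: "integrable lborel f" and g: "integrable lborel g"
  shows "integrable (lborel \<Otimes>\<^sub>M lborel) (\<lambda>(x, y). f x * g y)"
proof (rule lborel_pair.Fubini_integrable)
  have [measurable]: "f \<in> borel_measurable lborel" "g \<in> borel_measurable lborel"
    using assms by auto
  show "(\<lambda>(x, y). f x * g y) \<in> borel_measurable (lborel \<Otimes>\<^sub>M lborel)"
    by measurable
qed (use f g in \<open>simp_all add: norm_mult\<close>)

lemma trace_matrix_mult: "trace (A ** B) = (\<Sum>k\<in>UNIV. \<Sum>l\<in>UNIV. A $ k $ l * B $ l $ k)"
  by (simp add: trace_def matrix_matrix_mult_def)

text \<open>The trace is a finite sum of products of an entry in \<open>s\<close> and an entry in
  \<open>t\<close>, each integrable on the product space.\<close>

lemma integrable_pair_trace: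
  fixes A B :: "real \<Rightarrow> complex^'n^'n"
  assumes "integrable lborel A" and "integrable lborel B"
  shows "integrable (lborel \<Otimes>\<^sub>M lborel) (\<lambda>(s, t). trace (A s ** B t))"
proof -
  have nth: "integrable lborel (\<lambda>s. C s $ k $ l)"
    if "integrable lborel C" for C :: "real \<Rightarrow> complex^'n^'n" and k l
    using that
    by (rule integrable_bounded_linear[rotated, where T = "\<lambda>x. x $ k $ l"])
      (intro bounded_linear_compose[OF bounded_linear_vec_nth bounded_linear_vec_nth])
  have "integrable (lborel \<Otimes>\<^sub>M lborel)
      (\<lambda>p. \<Sum>k\<in>UNIV. \<Sum>l\<in>UNIV. (case p of (s, t) \<Rightarrow> A s $ k $ l * B t $ l $ k))"
    by (intro Bochner_Integration.integrable_sum integrable_pair_mult nth assms)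
  then show ?thesis
    by (simp add: trace_matrix_mult case_prod_beta')
qed

text \<open>The integrand separates: resolvents of one matrix commute, and cyclicity moves one of
  them to the end, leaving the trace of a factor in \<open>s\<close> times a factor in
  \<open>t\<close>. Both integrals can then be pulled into the trace.\<close>

lemma resolvent_double_integral:
  fixes S X Y :: "complex^'n^'n"
  assumes S: "positive_definite S" and p: "0 < p" "p < 1"
  defines "G \<equiv> \<lambda>s t. complex_of_real (s powr p * t powr (1 - p)) *
    trace (resolvent S s ** resolvent S t ** X ** resolvent S s ** resolvent S t ** Y)"
  shows "set_integrable (lborel \<Otimes>\<^sub>M lborel) ({0<..} \<times> {0<..}) (\<lambda>(s, t). G s t)"
    and "complex_of_real ((sin (p * pi))\<^sup>2 / pi\<^sup>2) * (LINT s:{0<..}|lborel. LINT t:{0<..}|lborel. G s t)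
      = trace (powr_quotient p S S X ** powr_quotient (1 - p) S S Y)"
proof -
  define A where "A s = indicator {0<..} s *\<^sub>R (s powr p *\<^sub>R (resolvent S s ** X ** resolvent S s))" for s
  define B where "B t = indicator {0<..} t *\<^sub>R (t powr (1 - p) *\<^sub>R (resolvent S t ** Y ** resolvent S t))" for t
  have A: "integrable lborel A" and B: "integrable lborel B"
    unfolding A_def B_def by (intro integrable_resolvent_sandwich S; use p in simp)+
  have G: "G s t = trace (A s ** B t)" if "0 < s" "0 < t" for s t
  proof -
    let ?R = "resolvent S"
    have "trace (?R s ** ?R t ** X ** ?R s ** ?R t ** Y) = trace (?R t ** (?R s ** X ** ?R s ** ?R t ** Y))"
      using resolvent_commute[OF S, of s t] that by (simp add: matrix_mul_assoc)
    also have "\<dots> = trace (?R s ** X ** ?R s ** ?R t ** Y ** ?R t)"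
      by (rule trace_mul_sym)
    finally show ?thesis
      using that
      by (simp add: G_def A_def B_def matrix_mult.scaleR_left matrix_mult.scaleR_right
          linear_cmul[OF linear_trace] matrix_mul_assoc) (simp add: scaleR_conv_of_real mult_ac)
  qed
  have "indicator ({0<..} \<times> {0<..}) (s, t) *\<^sub>R G s t = trace (A s ** B t)" for s t
    by (cases "0 < s \<and> 0 < t") (auto simp: G, auto simp: A_def B_def indicator_def trace_def)
  then have "(\<lambda>z. indicator ({0<..} \<times> {0<..}) z *\<^sub>R (case z of (s, t) \<Rightarrow> G s t))
      = (\<lambda>(s, t). trace (A s ** B t))"
    by (intro ext) (simp only: split_paired_all prod.case)
  then show "set_integrable (lborel \<Otimes>\<^sub>M lborel) ({0<..} \<times> {0<..}) (\<lambda>(s, t). G s t)"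
    unfolding set_integrable_def using integrable_pair_trace[OF A B] by (simp only:)
  have inner: "indicator {0<..} s *\<^sub>R (LINT t:{0<..}|lborel. G s t) = trace (A s ** integral\<^sup>L lborel B)" for s
  proof (cases "0 < s")
    case True
    have "indicator {0<..} t *\<^sub>R G s t = trace (A s ** B t)" for t
      using True by (cases "0 < t") (auto simp: G, auto simp: B_def trace_def)
    then show ?thesis
      using True integral_bounded_linear[OF bounded_linear_trace_mult(2) B, of "A s"]
      by (simp add: set_lebesgue_integral_def)
  qed (simp add: A_def trace_def)
  have "(LINT s:{0<..}|lborel. LINT t:{0<..}|lborel. G s t)
      = trace (integral\<^sup>L lborel A ** integral\<^sup>L lborel B)"
    using integral_bounded_linear[OF bounded_linear_trace_mult(1) A, of "integral\<^sup>L lborel B"]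
    by (simp add: set_lebesgue_integral_def[of _ "{0<..}" "\<lambda>s. LINT t:{0<..}|lborel. G s t"] inner)
  moreover have "powr_quotient p S S X = (sin (p * pi) / pi) *\<^sub>R integral\<^sup>L lborel A"
    by (simp only: powr_quotient_def set_lebesgue_integral_def A_def[abs_def])
  \<comment> \<open>The two prefactors coincide, which produces the squared sine.\<close>
  moreover have "sin ((1 - p) * pi) = sin (p * pi)"
    using sin_pi_minus[of "p * pi"] by (simp add: left_diff_distrib)
  then have "powr_quotient (1 - p) S S Y = (sin (p * pi) / pi) *\<^sub>R integral\<^sup>L lborel B"
    by (simp only: powr_quotient_def set_lebesgue_integral_def B_def[abs_def])
  ultimately show "complex_of_real ((sin (p * pi))\<^sup>2 / pi\<^sup>2) * (LINT s:{0<..}|lborel. LINT t:{0<..}|lborel. G s t)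
      = trace (powr_quotient p S S X ** powr_quotient (1 - p) S S Y)"
    by (simp add: matrix_mult.scaleR_left matrix_mult.scaleR_right linear_cmul[OF linear_trace])
      (simp add: scaleR_conv_of_real power2_eq_square)
qed

section \<open>Derivatives of the entropy along coordinate axes\<close>

lemma has_vector_derivative_along_axis:
  fixes f :: "real^'l \<Rightarrow> 'b::real_normed_vector"
  assumes "(f has_derivative f') (at x)"
  shows "((\<lambda>h. f (x + h *\<^sub>R axis i 1)) has_vector_derivative f' (axis i 1)) (at 0)"
proof -
  have "((\<lambda>h. x + h *\<^sub>R axis i 1) has_derivative (\<lambda>h. h *\<^sub>R axis i 1)) (at 0)"
    by (auto intro!: derivative_eq_intros)
  from has_derivative_compose[OF this, of f f'] assms
  have "((\<lambda>h. f (x + h *\<^sub>R axis i 1)) has_derivative (\<lambda>h. f' (h *\<^sub>R axis i 1))) (at 0)"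
    by simp
  then show ?thesis
    by (simp add: has_vector_derivative_def linear_cmul[OF has_derivative_linear[OF assms]])
qed

text \<open>The first derivative of the logarithm is \<open>q / Q\<close>. Since
  \<open>Q 0 = 1\<close> and \<open>q 0 = 0\<close>, the quotient rule at 0 leaves just the
  derivative of \<open>q\<close>.\<close>

theorem petz_renyi_information_eq_trace:
  fixes \<rho> :: "real^'l \<Rightarrow> complex^'n^'n" and \<theta> :: "real^'l" and \<alpha> :: real and i j :: 'l
  assumes diff: "twice_differentiable \<rho>"
    and state: "\<And>\<theta>. is_state (\<rho> \<theta>)"
    and pd: "\<And>\<theta>. positive_definite (\<rho> \<theta>)"
    and \<alpha>: "0 < \<alpha>" "\<alpha> < 1"
  shows "complex_of_real (petz_renyi_information \<alpha> \<rho> \<theta> $ i $ j) = complex_of_real (1 / (\<alpha> * (1 - \<alpha>))) *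
    trace (powr_quotient \<alpha> (\<rho> \<theta>) (\<rho> \<theta>) (partial_deriv i \<rho> \<theta>) **
      powr_quotient (1 - \<alpha>) (\<rho> \<theta>) (\<rho> \<theta>) (partial_deriv j \<rho> \<theta>))"
proof -
  let ?\<beta> = "1 - \<alpha>"
  let ?A = "matrix_powr (\<rho> \<theta>) \<alpha>"
  have \<beta>: "0 < ?\<beta>" "?\<beta> < 1"
    using \<alpha> by auto
  obtain \<rho>' where \<rho>': "\<And>x. (\<rho> has_derivative blinfun_apply (\<rho>' x)) (at x)"
    and \<rho>'': "\<And>x. \<rho>' differentiable at x"
    using diff unfolding twice_differentiable_def by blast
  have path: "((\<lambda>h. \<rho> (x + h *\<^sub>R axis k 1)) has_vector_derivative partial_deriv k \<rho> x) (at 0)" for x k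
    using has_vector_derivative_along_axis[OF \<rho>'] unfolding partial_deriv_def
    by (metis vector_derivative_at)
  have partial: "partial_deriv k \<rho> x = blinfun_apply (\<rho>' x) (axis k 1)" for x k
    unfolding partial_deriv_def by (rule vector_derivative_at[OF has_vector_derivative_along_axis[OF \<rho>']])
  have trace_1: "trace (\<rho> x) = 1" for x
    using state by (simp add: is_state_def)
  have trace_0: "trace (partial_deriv k \<rho> x) = 0" for x k
  proof -
    have "((\<lambda>h. trace (\<rho> (x + h *\<^sub>R axis k 1))) has_vector_derivative trace (partial_deriv k \<rho> x)) (at 0)"
      by (rule bounded_linear.has_vector_derivative[OF bounded_linear_trace path])
    then show ?thesis
      unfolding trace_1 by (rule vector_derivative_unique_at) (rule has_vector_derivative_const)
  qed
  \<comment> \<open>\<open>Q\<close> is the trace inside the logarithm and \<open>q\<close> its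
    partial derivative in direction \<open>j\<close>.\<close>
  define Q where "Q \<epsilon> = Re (trace (?A ** matrix_powr (\<rho> (\<theta> + \<epsilon>)) ?\<beta>))" for \<epsilon>
  define q where "q \<epsilon> = Re (trace (?A ** powr_quotient ?\<beta> (\<rho> (\<theta> + \<epsilon>)) (\<rho> (\<theta> + \<epsilon>)) (partial_deriv j \<rho> (\<theta> + \<epsilon>))))" for \<epsilon>
  have Q_deriv: "((\<lambda>h. Q (\<epsilon> + h *\<^sub>R axis k 1)) has_real_derivative
      Re (trace (?A ** powr_quotient ?\<beta> (\<rho> (\<theta> + \<epsilon>)) (\<rho> (\<theta> + \<epsilon>)) (partial_deriv k \<rho> (\<theta> + \<epsilon>))))) (at 0)" for \<epsilon> k
    using bounded_linear.has_vector_derivative[OF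
        bounded_linear_compose[OF bounded_linear_Re bounded_linear_trace_mult(2)]
        has_vector_derivative_matrix_powr[OF path pd \<beta>, of "\<theta> + \<epsilon>" k]]
    by (simp add: Q_def has_real_derivative_iff_has_vector_derivative add.assoc)
  have Q_0: "Q 0 = 1"
    by (simp add: Q_def trace_matrix_powr_mult_matrix_powr[OF pd] trace_1)
  have D: "petz_renyi_entropy \<alpha> (\<rho> \<theta>) (\<rho> (\<theta> + \<epsilon>)) = 1 / (\<alpha> - 1) * ln (Q \<epsilon>)" for \<epsilon>
    by (simp add: petz_renyi_entropy_def Q_def)
  have first: "partial_deriv j (\<lambda>\<epsilon>. petz_renyi_entropy \<alpha> (\<rho> \<theta>) (\<rho> (\<theta> + \<epsilon>))) \<epsilon>
      = 1 / (\<alpha> - 1) * (q \<epsilon> / Q \<epsilon>)" if "0 < Q \<epsilon>" for \<epsilon>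
  proof -
    have "((\<lambda>h. 1 / (\<alpha> - 1) * ln (Q (\<epsilon> + h *\<^sub>R axis j 1))) has_real_derivative
        1 / (\<alpha> - 1) * (q \<epsilon> / Q \<epsilon>)) (at 0)"
      using Q_deriv[of \<epsilon> j] that \<alpha> by (auto intro!: derivative_eq_intros simp: q_def)
    then show ?thesis
      unfolding partial_deriv_def D
      by (intro vector_derivative_at) (simp add: has_real_derivative_iff_has_vector_derivative)
  qed
  \<comment> \<open>Second-order differentiability enters here, as continuity of
    \<open>\<rho>'\<close>. The summand \<open>0 *\<^sub>R axis i 1\<close> keeps the limit in the
    form of the value of the curve at 0.\<close>
  have cont: "((\<lambda>h. partial_deriv j \<rho> (\<theta> + h *\<^sub>R axis i 1)) \<longlongrightarrow> partial_deriv j \<rho> (\<theta> + 0 *\<^sub>R axis i 1)) (at 0)"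
  proof -
    have "isCont \<rho>' (\<theta> + 0 *\<^sub>R axis i 1)"
      using \<rho>'' by (rule differentiable_imp_continuous_within)
    moreover have "((\<lambda>h. \<theta> + h *\<^sub>R axis i 1) \<longlongrightarrow> \<theta> + 0 *\<^sub>R axis i 1) (at (0::real))"
      by (intro tendsto_intros)
    ultimately have "((\<lambda>h. \<rho>' (\<theta> + h *\<^sub>R axis i 1)) \<longlongrightarrow> \<rho>' (\<theta> + 0 *\<^sub>R axis i 1)) (at 0)"
      by (rule isCont_tendsto_compose)
    then show ?thesis
      unfolding partial by (intro tendsto_intros)
  qed
  let ?T = "trace (powr_quotient \<alpha> (\<rho> \<theta>) (\<rho> \<theta>) (partial_deriv i \<rho> \<theta>) **
      powr_quotient ?\<beta> (\<rho> \<theta>) (\<rho> \<theta>) (partial_deriv j \<rho> \<theta>))"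
  have q_deriv: "((\<lambda>h. q (h *\<^sub>R axis i 1)) has_real_derivative - Re ?T) (at 0)"
    using bounded_linear.has_vector_derivative[OF bounded_linear_Re
        has_derivative_trace_powr_quotient[OF path[of \<theta> i] cont pd trace_0 \<alpha>]]
    by (simp add: q_def has_real_derivative_iff_has_vector_derivative)
  have q_0: "q 0 = 0"
    using trace_matrix_powr_mult_powr_quotient[OF pd \<beta>, of \<theta> "partial_deriv j \<rho> \<theta>"]
    by (simp add: q_def trace_0)
  have Q_i: "((\<lambda>h. Q (h *\<^sub>R axis i 1)) has_real_derivative
      Re (trace (?A ** powr_quotient ?\<beta> (\<rho> \<theta>) (\<rho> \<theta>) (partial_deriv i \<rho> \<theta>)))) (at 0)"
    using Q_deriv[of 0 i] by simp
  have deriv: "((\<lambda>h. 1 / (\<alpha> - 1) * (q (h *\<^sub>R axis i 1) / Q (h *\<^sub>R axis i 1))) has_real_derivative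
      1 / (\<alpha> - 1) * - Re ?T) (at 0)"
    by (rule derivative_eq_intros q_deriv Q_i refl | simp add: Q_0 q_0)+
  \<comment> \<open>The formula \<open>first\<close> presupposes that \<open>Q\<close> is positive,
    which continuity grants near 0. The congruence rule for derivatives asks for equality on a full
    neighbourhood, with 0 included.\<close>
  have ev: "\<forall>\<^sub>F h in nhds 0. 1 / (\<alpha> - 1) * (q (h *\<^sub>R axis i 1) / Q (h *\<^sub>R axis i 1))
      = partial_deriv j (\<lambda>\<epsilon>. petz_renyi_entropy \<alpha> (\<rho> \<theta>) (\<rho> (\<theta> + \<epsilon>))) (0 + h *\<^sub>R axis i 1)"
  proof -
    have "((\<lambda>h. Q (h *\<^sub>R axis i 1)) \<longlongrightarrow> Q (0 *\<^sub>R axis i 1)) (nhds 0)"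
      using DERIV_isCont[OF Q_i] by (simp add: isCont_def tendsto_nhds_iff)
    then have "\<forall>\<^sub>F h in nhds 0. 0 < Q (h *\<^sub>R axis i 1)"
      by (rule order_tendstoD) (simp add: Q_0)
    then show ?thesis
      by eventually_elim (simp add: first)
  qed
  have "((\<lambda>h. partial_deriv j (\<lambda>\<epsilon>. petz_renyi_entropy \<alpha> (\<rho> \<theta>) (\<rho> (\<theta> + \<epsilon>)))
      (0 + h *\<^sub>R axis i 1)) has_real_derivative 1 / (\<alpha> - 1) * - Re ?T) (at 0)"
    by (rule iffD1[OF DERIV_cong_ev[OF refl ev refl] deriv])
  then have "partial_deriv i (partial_deriv j (\<lambda>\<epsilon>. petz_renyi_entropy \<alpha> (\<rho> \<theta>) (\<rho> (\<theta> + \<epsilon>)))) 0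
      = 1 / (\<alpha> - 1) * - Re ?T"
    unfolding partial_deriv_def[of i]
    by (intro vector_derivative_at) (simp add: has_real_derivative_iff_has_vector_derivative)
  then have "petz_renyi_information \<alpha> \<rho> \<theta> $ i $ j = 1 / \<alpha> * (1 / (\<alpha> - 1) * - Re ?T)"
    by (simp add: petz_renyi_information_def)
  also have "\<dots> = 1 / (\<alpha> * (1 - \<alpha>)) * Re ?T"
    using \<alpha> by (simp add: divide_simps) (simp add: algebra_simps)
  finally have "complex_of_real (petz_renyi_information \<alpha> \<rho> \<theta> $ i $ j)
      = complex_of_real (1 / (\<alpha> * (1 - \<alpha>))) * complex_of_real (Re ?T)"
    by (simp only: of_real_mult)
  \<comment> \<open>These matrices are derivatives of curves of Hermitian powers, so the trace of
    their product is real.\<close>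
  moreover have "hermitian_matrix (powr_quotient p (\<rho> \<theta>) (\<rho> \<theta>) (partial_deriv k \<rho> \<theta>))"
    if "0 < p" "p < 1" for p k
    using hermitian_vector_derivative[OF has_vector_derivative_matrix_powr[OF path pd that]
        hermitian_matrix_powr[OF pd], of \<theta> k]
    by simp
  ultimately show ?thesis
    using trace_mult_hermitian_real \<alpha> \<beta> by metis
qed

text \<open>The integrability clause asserts absolute convergence of the double integral; without it
  the equation could refer to the default value 0 of a divergent Lebesgue integral.\<close>

theorem proposition18:
  fixes \<rho> :: "real^'l \<Rightarrow> complex^'n^'n" and \<theta> :: "real^'l" and \<alpha> :: real and i j :: 'l
  assumes "twice_differentiable \<rho>"
    and "\<And>\<theta>. is_state (\<rho> \<theta>)"
    and "\<And>\<theta>. positive_definite (\<rho> \<theta>)"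
    and "0 < \<alpha>" and "\<alpha> < 1"
  shows "let R = (\<lambda>s::real. matrix_inv (\<rho> \<theta> + s *\<^sub>R mat 1));
             G = (\<lambda>s t. complex_of_real (s powr \<alpha> * t powr (1 - \<alpha>)) *
                    trace (R s ** R t ** partial_deriv i \<rho> \<theta> ** R s ** R t ** partial_deriv j \<rho> \<theta>))
         in set_integrable (lborel \<Otimes>\<^sub>M lborel) ({0<..} \<times> {0<..}) (\<lambda>(s, t). G s t) \<and>
            complex_of_real (petz_renyi_information \<alpha> \<rho> \<theta> $ i $ j) =
              complex_of_real ((sin (\<alpha> * pi))\<^sup>2 / (\<alpha> * (1 - \<alpha>) * pi\<^sup>2)) *
              (LINT s:{0<..}|lborel. LINT t:{0<..}|lborel. G s t)"
proof -
  have "(sin (\<alpha> * pi))\<^sup>2 / (\<alpha> * (1 - \<alpha>) * pi\<^sup>2) = 1 / (\<alpha> * (1 - \<alpha>)) * ((sin (\<alpha> * pi))\<^sup>2 / pi\<^sup>2)"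
    by simp
  then show ?thesis
    unfolding Let_def resolvent_def[symmetric] petz_renyi_information_eq_trace[OF assms]
      resolvent_double_integral(2)[OF assms(3-5), symmetric]
    using resolvent_double_integral(1)[OF assms(3-5)] by (simp only: of_real_mult mult.assoc)
qed

end
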